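(* Every $\mathcal{G}_{\mathbb{C}}$-orbit in $\mathcal{D}_{\mathrm{all}}$ has a unique representative $(\alpha,\beta)$ of precisely one of the following forms, where $\xi_0^{\mathbb{C}},\xi_L^{\mathbb{C}}\in\mathbb{C}$ denote the numbers such that the diagonal parts of $\beta(0),\beta(L)$ are $-i\xi_0^{\mathbb{C}}\sigma_z$, $-i\xi^{\mathbb{C}}_L\sigma_z$. (i) $\alpha=\alpha_0\sigma_x$ with $\alpha_0=a+ic$ a constant, $a\in\mathbb{R}$, $c\in[0,\pi/2L]$, and $a>0$ if $c\in\{0,\pi/2L\}$; and $\beta=\beta_x\sigma_x+\beta_y\sigma_y+\beta_z\sigma_z$ with $$\beta_y(t)=\frac{-\xi_0^{\mathbb{C}}\cosh(2\alpha_0(L-t))+\xi_L^{\mathbb{C}}\cosh(2\alpha_0t)}{\sinh(2\alpha_0L)},\qquad \beta_z(t)=-i\,\frac{\xi_0^{\mathbb{C}}\sinh(2\alpha_0(L-t))+\xi_L^{\mathbb{C}}\sinh(2\alpha_0t)}{\sinh(2\alpha_0L)},$$ and $\beta_x$ an arbitrary complex constant. (ii) $\alpha=\begin{pmatrix}0&1/L\\0&0\end{pmatrix}$ and $\beta=-\frac iL\begin{pmatrix}\xi_0^{\mathbb{C}}(L-t)+\xi_L^{\mathbb{C}}t & \xi_L^{\mathbb{C}}(L+t^2/L)-\xi_0^{\mathbb{C}}(L-t)^2/L+c\\ (\xi_0^{\mathbb{C}}-\xi_L^{\mathbb{C}})L & -\xi_0^{\mathbb{C}}(L-t)-\xi_L^{\mathbb{C}}t\end{pmatrix}$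 for some constant $c\in\mathbb{C}$. (iii) $\alpha=\begin{pmatrix}0&0\\1/L&0\end{pmatrix}$ and $\beta=-\frac iL\begin{pmatrix}\xi_0^{\mathbb{C}}(L-t)+\xi_L^{\mathbb{C}}t & -(\xi_0^{\mathbb{C}}-\xi_L^{\mathbb{C}})L\\ \xi_0^{\mathbb{C}}(L-t)^2/L-\xi_L^{\mathbb{C}}(L+t^2/L)+c & -\xi_0^{\mathbb{C}}(L-t)-\xi_L^{\mathbb{C}}t\end{pmatrix}$ for some constant $c\in\mathbb{C}$. (iv), (v) The pairs obtained by applying the extended gauge transformation $\exp(i\pi t\sigma_x/2L)$ to the pairs in (ii), respectively (iii), with $\xi_L^{\mathbb{C}}$ replaced by $-\xi_L^{\mathbb{C}}$ there. (vi) If $\xi_0^{\mathbb{C}}=\xi_L^{\mathbb{C}}$: $\alpha=0$ and $\beta$ one of $\begin{pmatrix}-i\xi_0^{\mathbb{C}}&0\\0&i\xi_0^{\mathbb{C}}\end{pmatrix}$, $\begin{pmatrix}-i\xi_0^{\mathbb{C}}&1/L\\0&i\xi_0^{\mathbb{C}}\end{pmatrix}$, or $\begin{pmatrix}-i\xi_0^{\mathbb{C}}&c\\1/L&i\xi_0^{\mathbb{C}}\end{pmatrix}$ with $c\in\mathbb{C}$ a constant. (vii) If $\xi_0^{\mathbb{C}}=-\xi_L^{\mathbb{C}}$: the pairs obtained by applying the extended gauge transformation $\exp(i\pi t\sigma_x/2L)$ to the pairs $(\alpha,\beta)$ displayed in (vi). All of these have trivial stabilizers in $\mathcal{G}_{\mathbb{C}}$,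 except for the first pair in each of items (vi) and (vii), which have stabilizer $\mathbb{C}^\times$.
   Context: Fix $L>0$, $I=[0,L]$, $\partial I=\{0,L\}$, $t$ the coordinate, $\partial=d/dt$. $\sigma_x=\begin{pmatrix}0&1\\1&0\end{pmatrix}$, $\sigma_y=\begin{pmatrix}0&-i\\i&0\end{pmatrix}$, $\sigma_z=\begin{pmatrix}1&0\\0&-1\end{pmatrix}$. $T_{\mathbb{C}}\subset SL(2,\mathbb{C})$ is the diagonal subgroup and $\mathfrak{t}^\perp_{\mathbb{C}}\subset\mathfrak{sl}(2,\mathbb{C})$ the off-diagonal matrices. "$X|_{\partial I}\in S$" means $X(0),X(L)\in S$. $\mathcal{D}_{\mathrm{all}}=\{(\alpha,\beta)\in C^\infty(I,\mathfrak{sl}(2,\mathbb{C}))^{\oplus2}: \alpha|_{\partial I}\in\mathfrak{t}^\perp_{\mathbb{C}},\ \partial\beta+[\alpha,\beta]=0\}$. $\mathcal{G}_{\mathbb{C}}=\{g\in C^\infty(I,SL(2,\mathbb{C})): g|_{\partial I}\in T_{\mathbb{C}},\ g^{-1}\partial g|_{\partial I}\in\mathfrak{t}^\perp_{\mathbb{C}}\}/\{\pm1\}$, acting by $g(\alpha)=g^{-1}\alpha g+g^{-1}\partial g$, $g(\beta)=g^{-1}\beta g$. The extended gauge transformation $\exp(i\pi t\sigma_x/2L)$ (which is not in the gauge group but normalizes it) acts by the same formulas; it negates the diagonal part of $\beta(L)$. *)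

theory Defs
  imports "HOL-Analysis.Analysis" "HOL-Algebra.Group_Action"
begin

type_synonym cmat = "complex^2^2"

definition mat2 :: "complex \<Rightarrow> complex \<Rightarrow> complex \<Rightarrow> complex \<Rightarrow> cmat" where
  "mat2 a b c d = vector [vector [a, b], vector [c, d]]"

definition smult_mat :: "complex \<Rightarrow> cmat \<Rightarrow> cmat" (infixr "*\<^sub>m" 75) where
  "c *\<^sub>m A = map_matrix (\<lambda>x. c * x) A"

definition sigma_x :: cmat where "sigma_x = mat2 0 1 1 0"
definition sigma_y :: cmat where "sigma_y = mat2 0 (- \<i>) \<i> 0"
definition sigma_z :: cmat where "sigma_z = mat2 1 0 0 (- 1)"

definition commutator :: "cmat \<Rightarrow> cmat \<Rightarrow> cmat" where
  "commutator A B = A ** B - B ** A"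

definition diag_part :: "cmat \<Rightarrow> cmat" where
  "diag_part A = mat2 (A$1$1) 0 0 (A$2$2)"

definition SL2 :: "cmat set" where "SL2 = {A. det A = 1}"
definition sl2 :: "cmat set" where "sl2 = {A. trace A = 0}"
definition T_C :: "cmat set" where "T_C = {A \<in> SL2. A$1$2 = 0 \<and> A$2$1 = 0}"
definition t_perp :: "cmat set" where "t_perp = {A \<in> sl2. A$1$1 = 0 \<and> A$2$2 = 0}"

definition mat_exp :: "cmat \<Rightarrow> cmat" where
  "mat_exp A = (\<Sum>n. (1 / fact n) *\<^sub>R (((\<lambda>B. A ** B) ^^ n) (mat 1)))"

text \<open>
  A function on the interval from 0 to L is represented by a function on the reals that is
  extensional (equal to \<^const>\<open>undefined\<close> outside the interval), so that equality of fields
  and of gauge transformations is equality on the interval. Derivatives are taken within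
  the interval, hence one-sided at the endpoints.
\<close>

definition ddt :: "real \<Rightarrow> (real \<Rightarrow> cmat) \<Rightarrow> real \<Rightarrow> cmat" where
  "ddt L f = (\<lambda>t\<in>{0..L}. vector_derivative f (at t within {0..L}))"

definition C_inf :: "real \<Rightarrow> cmat set \<Rightarrow> (real \<Rightarrow> cmat) set" where
  "C_inf L S = {f \<in> {0..L} \<rightarrow>\<^sub>E S. \<forall>n. ((ddt L) ^^ n) f differentiable_on {0..L}}"

type_synonym field_pair = "(real \<Rightarrow> cmat) \<times> (real \<Rightarrow> cmat)"

definition D_all :: "real \<Rightarrow> field_pair set" where
  "D_all L = {(\<alpha>, \<beta>). \<alpha> \<in> C_inf L sl2 \<and> \<beta> \<in> C_inf L sl2 \<and>
     (\<forall>t\<in>{0, L}. \<alpha> t \<in> t_perp) \<and>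
     (\<forall>t\<in>{0..L}. ddt L \<beta> t + commutator (\<alpha> t) (\<beta> t) = 0)}"

text \<open>
  The group of matrix-valued gauge transformations, of which the gauge group is the quotient
  by the two constants 1 and -1.
\<close>

definition gauge_lift :: "real \<Rightarrow> (real \<Rightarrow> cmat) monoid" where
  "gauge_lift L =
     \<lparr>carrier = {g \<in> C_inf L SL2. \<forall>t\<in>{0, L}. g t \<in> T_C \<and> matrix_inv (g t) ** ddt L g t \<in> t_perp},
      mult = (\<lambda>g h. \<lambda>t\<in>{0..L}. g t ** h t),
      one = (\<lambda>t\<in>{0..L}. mat 1)\<rparr>"

definition gauge_group :: "real \<Rightarrow> (real \<Rightarrow> cmat) set monoid" where
  "gauge_group L = gauge_lift L Mod {\<lambda>t\<in>{0..L}. mat 1, \<lambda>t\<in>{0..L}. - mat 1}"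

definition gauge_act :: "real \<Rightarrow> (real \<Rightarrow> cmat) \<Rightarrow> field_pair \<Rightarrow> field_pair" where
  "gauge_act L g = (\<lambda>(\<alpha>, \<beta>).
     (\<lambda>t\<in>{0..L}. matrix_inv (g t) ** \<alpha> t ** g t + matrix_inv (g t) ** ddt L g t,
      \<lambda>t\<in>{0..L}. matrix_inv (g t) ** \<beta> t ** g t))"

text \<open>
  The action of a class modulo sign is the common value of \<^const>\<open>gauge_act\<close> on its two members.
  This is a right action; the library's \<^const>\<open>orbits\<close> and \<^const>\<open>stabilizer\<close> do not depend
  on the side.
\<close>

definition gauge_act_mod :: "real \<Rightarrow> (real \<Rightarrow> cmat) set \<Rightarrow> field_pair \<Rightarrow> field_pair" where
  "gauge_act_mod L U p = the_elem ((\<lambda>g. gauge_act L g p) ` U)"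

definition ext_gauge :: "real \<Rightarrow> real \<Rightarrow> cmat" where
  "ext_gauge L = (\<lambda>t\<in>{0..L}. mat_exp ((\<i> * of_real (pi * t / (2 * L))) *\<^sub>m sigma_x))"

definition C_times :: "complex monoid" where
  "C_times = \<lparr>carrier = UNIV - {0}, mult = (*), one = 1\<rparr>"

definition form_i :: "real \<Rightarrow> complex \<Rightarrow> complex \<Rightarrow> field_pair set" where
  "form_i L \<xi>0 \<xi>L =
     {(\<lambda>t\<in>{0..L}. \<alpha>0 *\<^sub>m sigma_x,
       \<lambda>t\<in>{0..L}. \<beta>x *\<^sub>m sigma_x
         + ((- \<xi>0 * cosh (2 * \<alpha>0 * of_real (L - t)) + \<xi>L * cosh (2 * \<alpha>0 * of_real t))
             / sinh (2 * \<alpha>0 * of_real L)) *\<^sub>m sigma_y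
         + (- \<i> * ((\<xi>0 * sinh (2 * \<alpha>0 * of_real (L - t)) + \<xi>L * sinh (2 * \<alpha>0 * of_real t))
             / sinh (2 * \<alpha>0 * of_real L))) *\<^sub>m sigma_z)
      | \<alpha>0 \<beta>x a c. \<alpha>0 = of_real a + \<i> * of_real c \<and> c \<in> {0..pi / (2 * L)} \<and>
          (c \<in> {0, pi / (2 * L)} \<longrightarrow> a > 0)}"

definition form_ii :: "real \<Rightarrow> complex \<Rightarrow> complex \<Rightarrow> field_pair set" where
  "form_ii L \<xi>0 \<xi>L =
     {(\<lambda>t\<in>{0..L}. mat2 0 (1 / of_real L) 0 0,
       \<lambda>t\<in>{0..L}. (- (\<i> / of_real L)) *\<^sub>m mat2
         (\<xi>0 * of_real (L - t) + \<xi>L * of_real t)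
         (\<xi>L * of_real (L + t\<^sup>2 / L) - \<xi>0 * of_real ((L - t)\<^sup>2 / L) + c)
         ((\<xi>0 - \<xi>L) * of_real L)
         (- \<xi>0 * of_real (L - t) - \<xi>L * of_real t))
      | c. True}"

definition form_iii :: "real \<Rightarrow> complex \<Rightarrow> complex \<Rightarrow> field_pair set" where
  "form_iii L \<xi>0 \<xi>L =
     {(\<lambda>t\<in>{0..L}. mat2 0 0 (1 / of_real L) 0,
       \<lambda>t\<in>{0..L}. (- (\<i> / of_real L)) *\<^sub>m mat2
         (\<xi>0 * of_real (L - t) + \<xi>L * of_real t)
         (- (\<xi>0 - \<xi>L) * of_real L)
         (\<xi>0 * of_real ((L - t)\<^sup>2 / L) - \<xi>L * of_real (L + t\<^sup>2 / L) + c)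
         (- \<xi>0 * of_real (L - t) - \<xi>L * of_real t))
      | c. True}"

definition form_iv :: "real \<Rightarrow> complex \<Rightarrow> complex \<Rightarrow> field_pair set" where
  "form_iv L \<xi>0 \<xi>L = gauge_act L (ext_gauge L) ` form_ii L \<xi>0 (- \<xi>L)"

definition form_v :: "real \<Rightarrow> complex \<Rightarrow> complex \<Rightarrow> field_pair set" where
  "form_v L \<xi>0 \<xi>L = gauge_act L (ext_gauge L) ` form_iii L \<xi>0 (- \<xi>L)"

text \<open>The three kinds of pairs displayed in the sixth item.\<close>

definition pair_vi_1 :: "real \<Rightarrow> complex \<Rightarrow> field_pair" where
  "pair_vi_1 L \<xi>0 =
     (\<lambda>t\<in>{0..L}. 0, \<lambda>t\<in>{0..L}. mat2 (- \<i> * \<xi>0) 0 0 (\<i> * \<xi>0))"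

definition pair_vi_2 :: "real \<Rightarrow> complex \<Rightarrow> field_pair" where
  "pair_vi_2 L \<xi>0 =
     (\<lambda>t\<in>{0..L}. 0, \<lambda>t\<in>{0..L}. mat2 (- \<i> * \<xi>0) (1 / of_real L) 0 (\<i> * \<xi>0))"

definition pair_vi_3 :: "real \<Rightarrow> complex \<Rightarrow> complex \<Rightarrow> field_pair" where
  "pair_vi_3 L \<xi>0 c =
     (\<lambda>t\<in>{0..L}. 0, \<lambda>t\<in>{0..L}. mat2 (- \<i> * \<xi>0) c (1 / of_real L) (\<i> * \<xi>0))"

definition pairs_vi :: "real \<Rightarrow> complex \<Rightarrow> field_pair set" where
  "pairs_vi L \<xi>0 = {pair_vi_1 L \<xi>0, pair_vi_2 L \<xi>0} \<union> {pair_vi_3 L \<xi>0 c | c. True}"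

definition form_vi :: "real \<Rightarrow> complex \<Rightarrow> complex \<Rightarrow> field_pair set" where
  "form_vi L \<xi>0 \<xi>L = (if \<xi>0 = \<xi>L then pairs_vi L \<xi>0 else {})"

definition form_vii :: "real \<Rightarrow> complex \<Rightarrow> complex \<Rightarrow> field_pair set" where
  "form_vii L \<xi>0 \<xi>L = (if \<xi>0 = - \<xi>L then gauge_act L (ext_gauge L) ` pairs_vi L \<xi>0 else {})"

datatype item = I | II | III | IV | V | VI | VII

fun form :: "item \<Rightarrow> real \<Rightarrow> complex \<Rightarrow> complex \<Rightarrow> field_pair set" where
  "form I = form_i"
| "form II = form_ii"
| "form III = form_iii"
| "form IV = form_iv"
| "form V = form_v"
| "form VI = form_vi"
| "form VII = form_vii"

definition normal_forms :: "real \<Rightarrow> item \<Rightarrow> field_pair set" where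
  "normal_forms L k = {(\<alpha>, \<beta>). \<exists>\<xi>0 \<xi>L.
     diag_part (\<beta> 0) = (- \<i> * \<xi>0) *\<^sub>m sigma_z \<and>
     diag_part (\<beta> L) = (- \<i> * \<xi>L) *\<^sub>m sigma_z \<and>
     (\<alpha>, \<beta>) \<in> form k L \<xi>0 \<xi>L}"

text \<open>The first pairs in the sixth and seventh items.\<close>

definition first_pairs :: "real \<Rightarrow> field_pair set" where
  "first_pairs L = range (pair_vi_1 L) \<union> range (\<lambda>\<xi>0. gauge_act L (ext_gauge L) (pair_vi_1 L \<xi>0))"

end

theory Submission
  imports Defs
begin

text \<open>
  Let \<open>U\<close> be the parallel transport of \<open>\<alpha>\<close>, that is \<open>\<partial>U = - \<alpha> U\<close> with \<open>U(0) = 1\<close>. The equation for \<open>\<beta>\<close>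
  says that \<open>\<beta> = U \<beta>(0) U\<^sup>-\<^sup>1\<close>, and a gauge transformation from \<open>(\<alpha>, \<beta>)\<close> to another pair with transport
  \<open>V\<close> must be \<open>g = U g(0) V\<^sup>-\<^sup>1\<close>. Conversely this formula gives a gauge transformation as soon as \<open>g(0)\<close>
  and \<open>g(L)\<close> lie in the torus, because the boundary condition on \<open>\<alpha>\<close> takes care of the condition on
  \<open>g\<^sup>-\<^sup>1 \<partial>g\<close>. Hence orbits correspond to pairs \<open>(M, B) = (U(L), \<beta>(0))\<close> of a unimodular and a traceless
  matrix, modulo \<open>(M, B) \<mapsto> (e\<^sup>-\<^sup>1 M d, d\<^sup>-\<^sup>1 B d)\<close> with \<open>d\<close>, \<open>e\<close> in the torus. This action rescales the two
  diagonal entries of \<open>M\<close> by inverse factors, and likewise the two off-diagonal entries. If no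
  entry vanishes, the product of the diagonal entries is the only invariant of \<open>M\<close>, it is
  \<open>cosh\<^sup>2 (\<alpha>\<^sub>0 L)\<close> in item (i), and \<open>\<plusminus>1\<close> is the stabilizer; the vanishing patterns give the other items.
  Only in items (vi) and (vii) a one-parameter group fixes \<open>M\<close>, and it is used to normalize \<open>B\<close>.
\<close>

text \<open>Write \<open>p, q, r, s\<close> for the entries of \<open>M\<close>. Since
  \<open>ps - qr = 1\<close>, the products \<open>ps\<close> and \<open>qr\<close> cannot both
  vanish, which leaves exactly seven patterns of zeros, one for each item: the generic one, three
  with \<open>qr = 0\<close> and three with \<open>ps = 0\<close>. The extended gauge transformation
  multiplies \<open>M\<close> from the left by an antidiagonal matrix, hence exchanges its rows up
  to a factor; this is why (iv), (v), (vii) are the images of (ii), (iii), (vi). In (i) to (v), for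
  fixed \<open>M\<close>, the parameters of \<beta> are coordinates for \<open>B\<close>: \<xi>0
  gives its diagonal, while \<xi>L, read off from the diagonal of \<beta>(L) = M B M^-1, and the
  remaining constant replace its two off-diagonal entries. So \<alpha> never has to be gauge fixed
  by hand; it suffices that the displayed pairs meet every class of \<open>(M, B)\<close> exactly
  once. Conjugation by \<open>d\<close> with upper left entry \<open>x\<close> scales the
  off-diagonal entries of \<open>B\<close> by the square of \<open>x\<close> or its inverse. This is
  why all rigidity statements have the form \<open>x\<^sup>2 = 1\<close>, which is triviality modulo
  sign.\<close>

section \<open>Linear differential equations\<close>

text \<open>Picard iteration. Linearity bounds the n-th iterated integral by a multiple of (C t)^n /
  n!, so the series converges on the whole interval at once and solutions on short intervals need
  not be glued.\<close>

lemma linear_ode_exists: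
  fixes prd :: "'a::real_normed_vector \<Rightarrow> 'b::banach \<Rightarrow> 'b"
  assumes bil: "bounded_bilinear prd" and cont: "continuous_on {0..L} A" and "0 \<le> L"
  obtains u where "u 0 = x0"
    and "\<And>t. t \<in> {0..L} \<Longrightarrow> (u has_vector_derivative prd (A t) (u t)) (at t within {0..L})"
proof -
  interpret bounded_bilinear prd by (rule bil)
  obtain K where K: "0 < K" "\<And>a b. norm (prd a b) \<le> norm a * norm b * K"
    using pos_bounded by blast
  have "bounded (A ` {0..L})"
    by (intro compact_imp_bounded compact_continuous_image cont) simp
  then obtain N where N: "0 < N" "\<And>t. t \<in> {0..L} \<Longrightarrow> norm (A t) \<le> N"
    unfolding bounded_pos by blast
  define C where "C = N * K"
  have C: "0 < C" "\<And>t b. t \<in> {0..L} \<Longrightarrow> norm (prd (A t) b) \<le> C * norm b"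
  proof -
    show "0 < C" using K N by (simp add: C_def)
    fix t b assume t: "t \<in> {0..L}"
    have "norm (prd (A t) b) \<le> norm (A t) * norm b * K" by (rule K)
    also have "\<dots> \<le> N * norm b * K"
      using N(2)[OF t] K(1) by (intro mult_right_mono) auto
    finally show "norm (prd (A t) b) \<le> C * norm b" by (simp add: C_def mult_ac)
  qed
  \<comment> \<open>The n-th term of the Picard series. The derivative of each term is
    \<open>prd (A t)\<close> applied to the term before it, so the sum formally solves the
    equation.\<close>
  define D where "D = rec_nat (\<lambda>_. x0) (\<lambda>_ d t. integral {0..t} (\<lambda>s. prd (A s) (d s)))"
  have D0: "D 0 = (\<lambda>_. x0)" and DS: "D (Suc n) = (\<lambda>t. integral {0..t} (\<lambda>s. prd (A s) (D n s)))" for n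
    by (simp_all add: D_def)
  have contD: "continuous_on {0..L} (D n)" for n
  proof (induction n)
    case (Suc n)
    show ?case unfolding DS
      by (intro indefinite_integral_continuous_1 integrable_continuous_real
          continuous_on cont Suc)
  qed (simp add: D0)
  have contAD: "continuous_on {0..L} (\<lambda>s. prd (A s) (D n s))" for n
    by (intro continuous_on cont contD)
  have derD: "(D (Suc n) has_vector_derivative prd (A t) (D n t)) (at t within {0..L})"
    if "t \<in> {0..L}" for n t
    unfolding DS by (rule integral_has_vector_derivative[OF contAD that])
  have boundD: "norm (D n t) \<le> norm x0 * (C * t) ^ n / fact n" if "t \<in> {0..L}" for n t
    using that
  proof (induction n arbitrary: t)
    case (Suc n)
    \<comment> \<open>The bound for \<open>Suc n\<close> is the antiderivative of \<open>C\<close>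
      times the bound for \<open>n\<close>, and it vanishes at 0.\<close>
    let ?g = "\<lambda>s. norm x0 * (C * s) ^ Suc n / fact (Suc n)"
    have "(?g has_vector_derivative C * (norm x0 * (C * s) ^ n / fact n)) (at s within {0..t})" for s
      unfolding has_real_derivative_iff_has_vector_derivative[symmetric]
      by (rule derivative_eq_intros refl | simp)+
    then have I: "((\<lambda>s. C * (norm x0 * (C * s) ^ n / fact n)) has_integral ?g t - ?g 0) {0..t}"
      using Suc.prems by (intro fundamental_theorem_of_calculus) auto
    have "norm (D (Suc n) t) \<le> integral {0..t} (\<lambda>s. C * (norm x0 * (C * s) ^ n / fact n))"
      unfolding DS
    proof (rule integral_norm_bound_integral)
      show "(\<lambda>s. prd (A s) (D n s)) integrable_on {0..t}"
        by (intro integrable_continuous_real continuous_on_subset[OF contAD]) (use Suc.prems in auto)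
      fix s assume "s \<in> {0..t}"
      then have s: "s \<in> {0..L}" using Suc.prems by auto
      show "norm (prd (A s) (D n s)) \<le> C * (norm x0 * (C * s) ^ n / fact n)"
        using C(2)[OF s, of "D n s"] mult_left_mono[OF Suc.IH[OF s], of C] C(1) by linarith
    qed (use I in blast)
    also have "\<dots> = ?g t" using integral_unique[OF I] by simp
    finally show ?case .
  qed (simp add: D0)
  have boundL: "norm (D n t) \<le> norm x0 * ((C * L) ^ n / fact n)" if "t \<in> {0..L}" for n t
  proof -
    have "(C * t) ^ n \<le> (C * L) ^ n" using that C(1) by (intro power_mono mult_left_mono) auto
    then have "norm x0 * (C * t) ^ n / fact n \<le> norm x0 * (C * L) ^ n / fact n"
      by (intro divide_right_mono mult_left_mono) auto
    then show ?thesis using boundD[OF that, of n] by simp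
  qed
  have "summable (\<lambda>n. norm x0 * ((C * L) ^ n / fact n))"
    using summable_exp[of "C * L"] by (intro summable_mult) (simp add: field_simps)
  define u where "u t = (\<Sum>n. D n t)" for t
  have unif: "uniform_limit {0..L} (\<lambda>n t. \<Sum>i<n. D i t) u sequentially"
    unfolding u_def by (rule Weierstrass_m_test) (fact boundL, fact)
  have sumsD: "(\<lambda>n. D n t) sums u t" if "t \<in> {0..L}" for t
    unfolding sums_def using tendsto_uniform_limitI[OF unif that] .
  \<comment> \<open>The derivatives of the terms as linear maps in \<open>h\<close>. The index drops
    by one, and the constant term \<open>D 0\<close> contributes zero.\<close>
  define f' where "f' n t h = (case n of 0 \<Rightarrow> 0 | Suc m \<Rightarrow> h *\<^sub>R prd (A t) (D m t))" for n t and h :: real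
  have "\<exists>g. \<forall>t\<in>{0..L}. (\<lambda>n. D n t) sums g t \<and>
      (g has_derivative (\<lambda>h. h *\<^sub>R prd (A t) (u t))) (at t within {0..L})"
  proof (rule has_derivative_series[where f' = f' and x = 0])
    show "(D n has_derivative f' n t) (at t within {0..L})" if "t \<in> {0..L}" for n t
    proof (cases n)
      case 0
      then have "f' n t = (\<lambda>_. 0)" by (simp add: f'_def fun_eq_iff)
      then show ?thesis by (simp add: 0 D0)
    next
      case (Suc m)
      then have "f' n t = (\<lambda>h. h *\<^sub>R prd (A t) (D m t))" by (simp add: f'_def fun_eq_iff)
      then show ?thesis using derD[OF that, of m] by (simp add: Suc has_vector_derivative_def)
    qed
    fix e :: real assume e: "0 < e"
    \<comment> \<open>The tolerance is divided by \<open>C\<close> because \<open>prd (A t)\<close>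
      may enlarge norms by that factor. Differentiating the first \<open>n\<close> terms gives
      \<open>prd (A t)\<close> of the sum of the first \<open>n - 1\<close>, hence the shift of the
      index below.\<close>
    then have "0 < e / C" using C(1) by simp
    from uniform_limitD[OF unif this]
    have "\<forall>\<^sub>F n in sequentially. \<forall>t\<in>{0..L}. dist (\<Sum>i<n. D i t) (u t) < e / C" .
    then have "\<forall>\<^sub>F n in sequentially. \<forall>t\<in>{0..L}. dist (\<Sum>i<n - 1. D i t) (u t) < e / C"
      unfolding eventually_sequentially
      by (metis add_leE le_add_diff_inverse2 nat_le_linear le_diff_conv2 Nat.le_diff_conv2)
    moreover have "\<forall>\<^sub>F n in sequentially. n > (0::nat)" by simp
    ultimately show "\<forall>\<^sub>F n in sequentially. \<forall>t\<in>{0..L}. \<forall>h.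
        norm (sum (\<lambda>i. f' i t h) {..<n} - h *\<^sub>R prd (A t) (u t)) \<le> e * norm h"
    proof eventually_elim
      case (elim n)
      then obtain m where n: "n = Suc m" by (cases n) auto
      show ?case
      proof (intro ballI allI)
        fix t h assume t: "t \<in> {0..L}"
        have "sum (\<lambda>i. f' i t h) {..<n} = (\<Sum>i<m. h *\<^sub>R prd (A t) (D i t))"
          unfolding n sum.lessThan_Suc_shift by (simp add: f'_def)
        also have "\<dots> = h *\<^sub>R prd (A t) (\<Sum>i<m. D i t)"
          by (simp add: sum_right scaleR_sum_right)
        finally have "norm (sum (\<lambda>i. f' i t h) {..<n} - h *\<^sub>R prd (A t) (u t))
            = \<bar>h\<bar> * norm (prd (A t) ((\<Sum>i<m. D i t) - u t))"
          by (simp add: diff_right flip: scaleR_diff_right)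
        also have "\<dots> \<le> \<bar>h\<bar> * (C * (e / C))"
        proof (intro mult_left_mono order_trans[OF C(2)[OF t]])
          show "norm ((\<Sum>i<m. D i t) - u t) \<le> e / C"
            using elim(1) t by (auto simp: n dist_norm intro: less_imp_le)
        qed (use C in auto)
        finally show "norm (sum (\<lambda>i. f' i t h) {..<n} - h *\<^sub>R prd (A t) (u t)) \<le> e * norm h"
          using C(1) by (simp add: mult.commute)
      qed
    qed
  qed (use sumsD \<open>0 \<le> L\<close> in auto)
  then obtain g where g: "\<And>t. t \<in> {0..L} \<Longrightarrow> (\<lambda>n. D n t) sums g t"
    "\<And>t. t \<in> {0..L} \<Longrightarrow> (g has_derivative (\<lambda>h. h *\<^sub>R prd (A t) (u t))) (at t within {0..L})"
    by blast
  have gu: "g t = u t" if "t \<in> {0..L}" for t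
    using sums_unique2 g(1) sumsD that by blast
  show ?thesis
  proof (rule that[of g])
    have "D n 0 = (if n = 0 then x0 else 0)" for n by (cases n) (simp_all add: D0 DS)
    then have "(\<lambda>n. D n 0) sums x0" using sums_single[of 0 "\<lambda>_. x0"] by (simp cong: if_cong)
    then show "g 0 = x0" using sums_unique2 g(1)[of 0] \<open>0 \<le> L\<close> by auto
  qed (simp add: g(2) gu has_vector_derivative_def)
qed

section \<open>Two by two matrices and smooth functions on the interval\<close>

lemma cmat_eq_iff:
  "(A::cmat) = B \<longleftrightarrow> A$1$1 = B$1$1 \<and> A$1$2 = B$1$2 \<and> A$2$1 = B$2$1 \<and> A$2$2 = B$2$2"
  by (simp add: vec_eq_iff forall_2)

lemma mat2_nth [simp]:
  "mat2 a b c d $ 1 $ 1 = a" "mat2 a b c d $ 1 $ 2 = b"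
  "mat2 a b c d $ 2 $ 1 = c" "mat2 a b c d $ 2 $ 2 = d"
  by (simp_all add: mat2_def)

lemma cmat_mult_nth:
  "((A::cmat) ** B) $ i $ j = A$i$1 * B$1$j + A$i$2 * B$2$j"
  by (simp add: matrix_matrix_mult_def sum_2)

lemma smult_mat_nth [simp]: "(c *\<^sub>m A) $ i $ j = c * A $ i $ j"
  by (simp add: smult_mat_def map_matrix_def)

lemma cmat_one_nth [simp]:
  "(mat 1 :: cmat) $ 1 $ 1 = 1" "(mat 1 :: cmat) $ 1 $ 2 = 0"
  "(mat 1 :: cmat) $ 2 $ 1 = 0" "(mat 1 :: cmat) $ 2 $ 2 = 1"
  by (simp_all add: mat_def)

lemma mat2_collapse: "mat2 (A$1$1) (A$1$2) (A$2$1) (A$2$2) = A"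
  by (simp add: cmat_eq_iff)

lemma mat2_eq_iff [simp]:
  "mat2 a b c d = mat2 a' b' c' d' \<longleftrightarrow> a = a' \<and> b = b' \<and> c = c' \<and> d = d'"
  by (simp add: cmat_eq_iff)

lemma mat2_mult:
  "mat2 a b c d ** mat2 a' b' c' d' =
    mat2 (a * a' + b * c') (a * b' + b * d') (c * a' + d * c') (c * b' + d * d')"
  by (simp add: cmat_eq_iff cmat_mult_nth)

lemma mat2_arith:
  "mat2 a b c d + mat2 a' b' c' d' = mat2 (a + a') (b + b') (c + c') (d + d')"
  "mat2 a b c d - mat2 a' b' c' d' = mat2 (a - a') (b - b') (c - c') (d - d')"
  "- mat2 a b c d = mat2 (- a) (- b) (- c) (- d)"
  "z *\<^sub>m mat2 a b c d = mat2 (z * a) (z * b) (z * c) (z * d)"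
  "(0::cmat) = mat2 0 0 0 0" "(mat 1 :: cmat) = mat2 1 0 0 1"
  by (simp_all add: cmat_eq_iff)

lemma trace_cmat: "trace (A::cmat) = A$1$1 + A$2$2"
  by (simp add: trace_def sum_2)

interpretation mm: bounded_bilinear "(**) :: cmat \<Rightarrow> cmat \<Rightarrow> cmat"
proof -
  have "bilinear ((**) :: cmat \<Rightarrow> cmat \<Rightarrow> cmat)"
    unfolding bilinear_def
    by (auto intro!: linearI simp: cmat_eq_iff cmat_mult_nth algebra_simps)
  then show "bounded_bilinear ((**) :: cmat \<Rightarrow> cmat \<Rightarrow> cmat)"
    by (simp add: bilinear_conv_bounded_bilinear)
qed

lemmas mm_simps = mm.add_left mm.add_right mm.diff_left mm.diff_right mm.minus_left mm.minus_right
  matrix_mul_assoc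

text \<open>The adjugate, which is the inverse on \<open>SL2\<close>. For two by two matrices it is
  linear, so regularity of an inverse becomes a case of bounded linear maps.\<close>

definition adj2 :: "cmat \<Rightarrow> cmat" where
  "adj2 A = mat2 (A$2$2) (- A$1$2) (- A$2$1) (A$1$1)"

lemma adj2_nth [simp]:
  "adj2 A $ 1 $ 1 = A$2$2" "adj2 A $ 1 $ 2 = - A$1$2"
  "adj2 A $ 2 $ 1 = - A$2$1" "adj2 A $ 2 $ 2 = A$1$1"
  by (simp_all add: adj2_def)

lemma bounded_linear_adj2: "bounded_linear adj2"
  unfolding linear_conv_bounded_linear[symmetric]
  by (rule linearI) (simp_all add: cmat_eq_iff)

lemma SL2_iff: "A \<in> SL2 \<longleftrightarrow> A$1$1 * A$2$2 - A$1$2 * A$2$1 = 1"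
  by (simp add: SL2_def det_2)

lemma sl2_iff: "A \<in> sl2 \<longleftrightarrow> A$2$2 = - A$1$1"
  by (simp add: sl2_def trace_cmat add_eq_0_iff)

text \<open>The last two equations are the cancellations in the middle of a product, since
  \<open>matrix_mul_assoc\<close> nests products to the left.\<close>

lemma SL2_adj2 [simp]:
  assumes "A \<in> SL2"
  shows "A ** adj2 A = mat 1" "adj2 A ** A = mat 1"
    "X ** A ** adj2 A = X" "X ** adj2 A ** A = X"
proof -
  show *: "A ** adj2 A = mat 1" "adj2 A ** A = mat 1"
    using assms by (auto simp: cmat_eq_iff cmat_mult_nth SL2_iff algebra_simps)
  show "X ** A ** adj2 A = X" "X ** adj2 A ** A = X"
    by (simp_all add: matrix_mul_assoc[symmetric] *)
qed

lemma SL2_mult: "A \<in> SL2 \<Longrightarrow> B \<in> SL2 \<Longrightarrow> A ** B \<in> SL2"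
  by (simp add: SL2_def det_mul)

lemma SL2_adj2_closed: "A \<in> SL2 \<Longrightarrow> adj2 A \<in> SL2"
  by (simp add: SL2_iff mult.commute)

lemma SL2_one: "mat 1 \<in> SL2"
  by (simp add: SL2_def)

lemma matrix_inv_SL2 [simp]:
  assumes "A \<in> SL2" shows "matrix_inv A = adj2 A"
proof -
  have "A ** matrix_inv A = mat 1 \<and> matrix_inv A ** A = mat 1"
    unfolding matrix_inv_def by (rule someI[of _ "adj2 A"]) (simp add: assms)
  then have "adj2 A ** A ** matrix_inv A = adj2 A ** mat 1"
    by (simp add: matrix_mul_assoc[symmetric])
  then show ?thesis by (simp add: assms)
qed

lemma bounded_linear_smult_mat: "bounded_linear (\<lambda>z. z *\<^sub>m A)"
  unfolding linear_conv_bounded_linear[symmetric]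
  by (rule linearI) (simp_all add: cmat_eq_iff algebra_simps)

lemma has_vector_derivative_mat2:
  assumes "(a has_vector_derivative a') F" "(b has_vector_derivative b') F"
    "(c has_vector_derivative c') F" "(d has_vector_derivative d') F"
  shows "((\<lambda>t. mat2 (a t) (b t) (c t) (d t)) has_vector_derivative mat2 a' b' c' d') F"
proof -
  have eq: "mat2 p q r s = p *\<^sub>m mat2 1 0 0 0 + q *\<^sub>m mat2 0 1 0 0 + r *\<^sub>m mat2 0 0 1 0
      + s *\<^sub>m mat2 0 0 0 1" for p q r s
    by (simp add: cmat_eq_iff)
  have "((\<lambda>t. a t *\<^sub>m mat2 1 0 0 0 + b t *\<^sub>m mat2 0 1 0 0 + c t *\<^sub>m mat2 0 0 1 0
      + d t *\<^sub>m mat2 0 0 0 1) has_vector_derivative a' *\<^sub>m mat2 1 0 0 0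
      + b' *\<^sub>m mat2 0 1 0 0 + c' *\<^sub>m mat2 0 0 1 0 + d' *\<^sub>m mat2 0 0 0 1) F"
    by (intro has_vector_derivative_add bounded_linear.has_vector_derivative[OF bounded_linear_smult_mat] assms)
  then show ?thesis by (simp only: eq[symmetric])
qed

lemma has_vector_derivative_entry:
  "((f::real \<Rightarrow> cmat) has_vector_derivative f') F \<Longrightarrow>
    ((\<lambda>t. f t $ i $ j) has_vector_derivative f' $ i $ j) F"
  by (intro bounded_linear.has_vector_derivative[OF bounded_linear_vec_nth])

section \<open>Derivatives and smooth functions on the closed interval\<close>

locale interval =
  fixes L :: real
  assumes L_pos: "0 < L"
begin

abbreviation J :: "real set" where "J \<equiv> {0..L}"

abbreviation hvd :: "(real \<Rightarrow> 'a::real_normed_vector) \<Rightarrow> 'a \<Rightarrow> real \<Rightarrow> bool"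
  where "hvd f f' t \<equiv> (f has_vector_derivative f') (at t within {0..L})"

lemma ends_in_J [simp]: "0 \<in> J" "L \<in> J"
  using L_pos by auto

lemma L_nonneg [simp]: "0 \<le> L"
  using L_pos by simp

text \<open>A derivative within \<open>J\<close> sees only the values on \<open>J\<close>, so an
  extensional field may be replaced by the formula that defines it there.\<close>

lemma hvd_cong:
  assumes "\<And>t. t \<in> J \<Longrightarrow> f t = g t" "t \<in> J"
  shows "hvd f f' t \<longleftrightarrow> hvd g f' t"
  using has_vector_derivative_transform[of t J] assms by metis

lemma ddt_eq: "t \<in> J \<Longrightarrow> hvd f f' t \<Longrightarrow> ddt L f t = f'"
  using L_pos vector_derivative_within_closed_interval[of 0 L t f f'] by (simp add: ddt_def)

lemma ddt_cong:
  assumes "\<And>t. t \<in> J \<Longrightarrow> f t = g t"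
  shows "ddt L f = ddt L g"
  unfolding ddt_def vector_derivative_def
  by (rule restrict_ext) (simp only: hvd_cong[of f g, OF assms])

lemma hvd_ddt: "f differentiable_on J \<Longrightarrow> t \<in> J \<Longrightarrow> hvd f (ddt L f t) t"
  by (simp add: ddt_def differentiable_on_def vector_derivative_works)

lemma hvd_unique: "t \<in> J \<Longrightarrow> hvd f a t \<Longrightarrow> hvd f b t \<Longrightarrow> a = (b::cmat)"
  using ddt_eq by metis

lemma hvd_zero_const:
  fixes f :: "real \<Rightarrow> 'a::real_normed_vector"
  assumes "\<And>t. t \<in> J \<Longrightarrow> hvd f 0 t" "t \<in> J"
  shows "f t = f 0"
  using has_vector_derivative_zero_constant[of J f] assms by (metis convex_real_interval(5) ends_in_J(1))

text \<open>Repeated differentiability with the first derivative split off, the recursion that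
  inductions with the sum and product rules follow. \<open>Ck_iff\<close> matches it with the
  iterates of \<open>ddt\<close> in \<open>C_inf\<close>.\<close>

primrec Ck :: "nat \<Rightarrow> (real \<Rightarrow> cmat) \<Rightarrow> bool" where
  "Ck 0 f \<longleftrightarrow> True"
| "Ck (Suc n) f \<longleftrightarrow> f differentiable_on J \<and> Ck n (ddt L f)"

definition smooth :: "(real \<Rightarrow> cmat) \<Rightarrow> bool" where
  "smooth f \<longleftrightarrow> (\<forall>n. Ck n f)"

lemma Ck_iff: "Ck n f \<longleftrightarrow> (\<forall>k<n. (ddt L ^^ k) f differentiable_on J)"
proof (induction n arbitrary: f)
  case (Suc n)
  have "Ck (Suc n) f \<longleftrightarrow> (ddt L ^^ 0) f differentiable_on J \<and>
      (\<forall>k<n. (ddt L ^^ Suc k) f differentiable_on J)"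
    by (simp add: Suc funpow_Suc_right del: funpow.simps(2))
  also have "\<dots> \<longleftrightarrow> (\<forall>k<Suc n. (ddt L ^^ k) f differentiable_on J)"
    by (rule All_less_Suc2[symmetric])
  finally show ?case .
qed simp

lemma C_inf_iff: "f \<in> C_inf L S \<longleftrightarrow> f \<in> J \<rightarrow>\<^sub>E S \<and> smooth f"
  unfolding C_inf_def smooth_def Ck_iff by auto

lemma Ck_cong: "(\<And>t. t \<in> J \<Longrightarrow> f t = g t) \<Longrightarrow> Ck n f \<longleftrightarrow> Ck n g"
proof (cases n)
  case (Suc m)
  assume eq: "\<And>t. t \<in> J \<Longrightarrow> f t = g t"
  then have "f differentiable_on J \<longleftrightarrow> g differentiable_on J"
    unfolding differentiable_on_def
    using hvd_cong[of f g, OF eq] differentiableI_vector vector_derivative_works by blast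
  then show ?thesis using ddt_cong[OF eq] by (simp add: Suc)
qed simp

lemma Ck_SucI:
  assumes "\<And>t. t \<in> J \<Longrightarrow> hvd f (f' t) t" "Ck n f'"
  shows "Ck (Suc n) f"
proof -
  have "Ck n (ddt L f)" using assms ddt_eq Ck_cong[of "ddt L f" f' n] by blast
  moreover have "f differentiable_on J"
    unfolding differentiable_on_def using assms(1) differentiableI_vector by blast
  ultimately show ?thesis by simp
qed

lemma Ck_SucE:
  assumes "Ck (Suc n) f"
  obtains f' where "\<And>t. t \<in> J \<Longrightarrow> hvd f (f' t) t" "Ck n f'"
  using assms hvd_ddt by auto

lemma Ck_Suc_imp: "Ck (Suc n) f \<Longrightarrow> Ck n f"
  by (induction n arbitrary: f) auto

lemma Ck_const: "Ck n (\<lambda>_. A)"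
proof (induction n arbitrary: A)
  case (Suc n)
  show ?case by (rule Ck_SucI[where f' = "\<lambda>_. 0"]) (auto intro: Suc)
qed simp

lemma Ck_add: "Ck n f \<Longrightarrow> Ck n g \<Longrightarrow> Ck n (\<lambda>t. f t + g t)"
proof (induction n arbitrary: f g)
  case (Suc n)
  from Suc.prems obtain f' g' where
    "\<And>t. t \<in> J \<Longrightarrow> hvd f (f' t) t" "Ck n f'" "\<And>t. t \<in> J \<Longrightarrow> hvd g (g' t) t" "Ck n g'"
    by (metis Ck_SucE)
  then show ?case
    by (intro Ck_SucI[where f' = "\<lambda>t. f' t + g' t"] has_vector_derivative_add Suc.IH)
qed simp

lemma Ck_linear:
  assumes h: "bounded_linear h"
  shows "Ck n f \<Longrightarrow> Ck n (\<lambda>t. h (f t))"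
proof (induction n arbitrary: f)
  case (Suc n)
  obtain f' where f': "\<And>t. t \<in> J \<Longrightarrow> hvd f (f' t) t" "Ck n f'"
    using Suc.prems by (rule Ck_SucE) blast
  show ?case
    using bounded_linear.has_vector_derivative[OF h f'(1)] Suc.IH[OF f'(2)] by (rule Ck_SucI)
qed simp

lemma Ck_mult: "Ck n f \<Longrightarrow> Ck n g \<Longrightarrow> Ck n (\<lambda>t. f t ** g t)"
proof (induction n arbitrary: f g)
  case (Suc n)
  obtain f' where f': "\<And>t. t \<in> J \<Longrightarrow> hvd f (f' t) t" "Ck n f'"
    using Suc.prems(1) by (rule Ck_SucE) blast
  obtain g' where g': "\<And>t. t \<in> J \<Longrightarrow> hvd g (g' t) t" "Ck n g'"
    using Suc.prems(2) by (rule Ck_SucE) blast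
  have "Ck n f" "Ck n g" using Suc.prems by (blast intro: Ck_Suc_imp)+
  then have "Ck n (\<lambda>t. f t ** g' t + f' t ** g t)"
    using Ck_add Suc.IH f'(2) g'(2) by blast
  with mm.has_vector_derivative[OF f'(1) g'(1)] show ?case by (rule Ck_SucI)
qed simp

lemma smooth_cong: "(\<And>t. t \<in> J \<Longrightarrow> f t = g t) \<Longrightarrow> smooth f \<longleftrightarrow> smooth g"
  unfolding smooth_def using Ck_cong by metis

lemma smooth_const: "smooth (\<lambda>_. A)"
  by (simp add: smooth_def Ck_const)

lemma smooth_add: "smooth f \<Longrightarrow> smooth g \<Longrightarrow> smooth (\<lambda>t. f t + g t)"
  by (simp add: smooth_def Ck_add)

lemma smooth_mult: "smooth f \<Longrightarrow> smooth g \<Longrightarrow> smooth (\<lambda>t. f t ** g t)"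
  by (simp add: smooth_def Ck_mult)

lemma smooth_linear: "bounded_linear h \<Longrightarrow> smooth f \<Longrightarrow> smooth (\<lambda>t. h (f t))"
  by (simp add: smooth_def Ck_linear)

lemma smooth_hvd: "smooth f \<Longrightarrow> t \<in> J \<Longrightarrow> hvd f (ddt L f t) t"
  unfolding smooth_def by (metis Ck.simps(2) hvd_ddt)

lemma smooth_ddt: "smooth f \<Longrightarrow> smooth (ddt L f)"
  unfolding smooth_def by (metis Ck.simps(2))

lemma smooth_restrict: "smooth (restrict f J) \<longleftrightarrow> smooth f"
  by (rule smooth_cong) simp

text \<open>Meant for differential equations, where \<open>f'\<close> is an expression in
  \<open>f\<close> and inherits its regularity; each use of the equation then gains one
  derivative.\<close>

lemma smooth_bootstrap:
  assumes "\<And>t. t \<in> J \<Longrightarrow> hvd f (f' t) t" "\<And>n. Ck n f \<Longrightarrow> Ck n f'"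
  shows "smooth f"
proof -
  have "Ck n f" for n
  proof (induction n)
    case (Suc n)
    then show ?case using assms Ck_SucI by blast
  qed simp
  then show ?thesis by (simp add: smooth_def)
qed

text \<open>Covers both the parallel transport equation and the equation for the second field.\<close>

lemma smooth_linear_ode:
  assumes "\<And>t. t \<in> J \<Longrightarrow> hvd f (a t ** f t + f t ** b t) t" "smooth a" "smooth b"
  shows "smooth f"
  using assms by (intro smooth_bootstrap[where f' = "\<lambda>t. a t ** f t + f t ** b t"])
    (auto intro!: Ck_add Ck_mult simp: smooth_def)

lemma smooth_imp_continuous: "smooth f \<Longrightarrow> continuous_on J f"
  by (meson continuous_on_vector_derivative smooth_hvd)

end

section \<open>Parallel transport and the holonomy of a pair\<close>

definition dg :: "complex \<Rightarrow> cmat" where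
  "dg x = mat2 x 0 0 (inverse x)"

lemma dg_nth [simp]: "dg x $ 1 $ 1 = x" "dg x $ 1 $ 2 = 0" "dg x $ 2 $ 1 = 0" "dg x $ 2 $ 2 = inverse x"
  by (simp_all add: dg_def)

lemma T_C_iff: "A \<in> T_C \<longleftrightarrow> (\<exists>x. x \<noteq> 0 \<and> A = dg x)"
proof
  assume A: "A \<in> T_C"
  then have e: "A$1$1 * A$2$2 = 1" "A$1$2 = 0" "A$2$1 = 0" by (auto simp: T_C_def SL2_iff)
  then have "A$1$1 \<noteq> 0" "A$2$2 = inverse (A$1$1)" by (auto simp: inverse_unique)
  then show "\<exists>x. x \<noteq> 0 \<and> A = dg x" using e by (auto simp: cmat_eq_iff)
qed (auto simp: T_C_def SL2_iff)

lemma T_C_imp_SL2: "A \<in> T_C \<Longrightarrow> A \<in> SL2"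
  by (simp add: T_C_def)

lemma t_perp_iff: "A \<in> t_perp \<longleftrightarrow> A$1$1 = 0 \<and> A$2$2 = 0"
  by (auto simp: t_perp_def sl2_iff)

lemma conj_t_perp: "D \<in> T_C \<Longrightarrow> A \<in> t_perp \<Longrightarrow> adj2 D ** A ** D \<in> t_perp"
  by (auto simp: T_C_iff t_perp_iff cmat_mult_nth)

lemma conj_sl2: "A \<in> SL2 \<Longrightarrow> B \<in> sl2 \<Longrightarrow> adj2 A ** B ** A \<in> sl2"
  unfolding sl2_def by (simp add: trace_mul_sym[of "adj2 A ** B"] matrix_mul_assoc)

lemma adj2_one [simp]: "adj2 (mat 1) = mat 1"
  by (simp add: cmat_eq_iff)

text \<open>For a gauge transformation \<open>g\<close> between pairs with transports
  \<open>U\<close> and \<open>W\<close>, these are the equations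
  \<open>U L ** g 0 = g L ** W L\<close> and \<open>\<beta> 0 ** g 0 = g 0 ** \<delta> 0\<close>,
  with \<open>x\<close> and \<open>y\<close> the upper left entries of \<open>g 0\<close> and
  \<open>g L\<close>. Without inverses they can be compared entry by entry.\<close>

definition torus_related :: "complex \<Rightarrow> complex \<Rightarrow> cmat \<Rightarrow> cmat \<Rightarrow> cmat \<Rightarrow> cmat \<Rightarrow> bool" where
  "torus_related x y M B M' B' \<longleftrightarrow> x \<noteq> 0 \<and> y \<noteq> 0 \<and> M ** dg x = dg y ** M' \<and> B ** dg x = dg x ** B'"

context interval
begin

text \<open>Smoothness of \<beta> follows from its linear equation and that of \<alpha>, by
  \<open>smooth_linear_ode\<close>.\<close>

lemma D_all_iff:
  "(\<alpha>, \<beta>) \<in> D_all L \<longleftrightarrow> \<alpha> \<in> J \<rightarrow>\<^sub>E sl2 \<and> \<beta> \<in> J \<rightarrow>\<^sub>E sl2 \<and> smooth \<alpha> \<and>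
    (\<forall>t\<in>{0, L}. \<alpha> t \<in> t_perp) \<and> (\<forall>t\<in>J. hvd \<beta> (\<beta> t ** \<alpha> t - \<alpha> t ** \<beta> t) t)"
proof -
  have "smooth \<beta> \<and> (\<forall>t\<in>J. ddt L \<beta> t + commutator (\<alpha> t) (\<beta> t) = 0) \<longleftrightarrow>
      (\<forall>t\<in>J. hvd \<beta> (\<beta> t ** \<alpha> t - \<alpha> t ** \<beta> t) t)" if "smooth \<alpha>"
  proof safe
    fix t assume t: "t \<in> J" and "\<forall>t\<in>J. ddt L \<beta> t + commutator (\<alpha> t) (\<beta> t) = 0" "smooth \<beta>"
    then have "ddt L \<beta> t = \<beta> t ** \<alpha> t - \<alpha> t ** \<beta> t"
      by (auto simp: commutator_def add_eq_0_iff2)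
    then show "hvd \<beta> (\<beta> t ** \<alpha> t - \<alpha> t ** \<beta> t) t"
      using smooth_hvd[OF \<open>smooth \<beta>\<close> t] by simp
  next
    assume h: "\<forall>t\<in>J. hvd \<beta> (\<beta> t ** \<alpha> t - \<alpha> t ** \<beta> t) t"
    have m: "smooth (\<lambda>t. - \<alpha> t)"
      using smooth_linear[OF bounded_linear_minus[OF bounded_linear_ident] that] .
    show "smooth \<beta>"
      by (rule smooth_linear_ode[OF _ m that]) (use h in \<open>simp add: mm_simps\<close>)
    fix t assume "t \<in> J"
    then have "ddt L \<beta> t = \<beta> t ** \<alpha> t - \<alpha> t ** \<beta> t" using ddt_eq h by blast
    then show "ddt L \<beta> t + commutator (\<alpha> t) (\<beta> t) = 0" by (simp add: commutator_def)
  qed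
  then show ?thesis unfolding D_all_def C_inf_iff by auto
qed

definition transport :: "(real \<Rightarrow> cmat) \<Rightarrow> (real \<Rightarrow> cmat) \<Rightarrow> bool" where
  "transport \<alpha> U \<longleftrightarrow> U 0 = mat 1 \<and> (\<forall>t\<in>J. hvd U (- (\<alpha> t ** U t)) t)"

lemma transport_exists:
  assumes "smooth \<alpha>" obtains U where "transport \<alpha> U"
proof -
  have "continuous_on J (\<lambda>t. - \<alpha> t)"
    by (intro continuous_intros smooth_imp_continuous assms)
  from linear_ode_exists[OF mm.bounded_bilinear_axioms this, of "mat 1"] L_pos
  obtain U where "U 0 = mat 1" "\<And>t. t \<in> J \<Longrightarrow> hvd U (- \<alpha> t ** U t) t"
    by auto
  then show ?thesis using that[of U] by (simp add: transport_def mm.minus_left)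
qed

text \<open>Liouville's formula: the logarithmic derivative of the determinant is minus the trace of
  \<alpha>, which vanishes.\<close>

lemma transport_SL2:
  assumes "transport \<alpha> U" "\<And>t. t \<in> J \<Longrightarrow> \<alpha> t \<in> sl2" "t \<in> J"
  shows "U t \<in> SL2"
proof -
  let ?d = "\<lambda>t. U t$1$1 * U t$2$2 - U t$1$2 * U t$2$1"
  have "hvd ?d 0 t" if t: "t \<in> J" for t
  proof -
    have U: "hvd U (- (\<alpha> t ** U t)) t" using assms(1) t by (simp add: transport_def)
    note e = has_vector_derivative_entry[OF U]
    show ?thesis
      by (rule has_vector_derivative_eq_rhs[OF has_vector_derivative_diff[OF
            has_vector_derivative_mult[OF e[of 1 1] e[of 2 2]]
            has_vector_derivative_mult[OF e[of 1 2] e[of 2 1]]]])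
        (use assms(2)[OF t] in \<open>simp add: sl2_iff cmat_mult_nth algebra_simps\<close>)
  qed
  from hvd_zero_const[OF this assms(3)] show ?thesis
    using assms(1) by (simp add: SL2_iff transport_def)
qed

lemma transport_smooth:
  assumes "transport \<alpha> U" "smooth \<alpha>" shows "smooth U"
proof -
  have m: "smooth (\<lambda>t. - \<alpha> t)"
    using smooth_linear[OF bounded_linear_minus[OF bounded_linear_ident] assms(2)] .
  show ?thesis
    by (rule smooth_linear_ode[OF _ m smooth_const[of 0]])
      (use assms(1) in \<open>simp add: transport_def mm_simps mm.zero_right\<close>)
qed

lemma adj2_derivative:
  assumes "\<And>t. t \<in> J \<Longrightarrow> g t \<in> SL2" "t \<in> J" "hvd g g' t"
  shows "hvd (\<lambda>t. adj2 (g t)) (- (adj2 (g t) ** g' ** adj2 (g t))) t"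
    and "adj2 (g t) ** g' \<in> sl2"
proof -
  have a: "hvd (\<lambda>t. adj2 (g t)) (adj2 g') t"
    by (rule bounded_linear.has_vector_derivative[OF bounded_linear_adj2 assms(3)])
  have "hvd (\<lambda>t. adj2 (g t) ** g t) 0 t \<longleftrightarrow> hvd (\<lambda>t. mat 1 :: cmat) 0 t"
    by (rule hvd_cong) (use assms in auto)
  then have "hvd (\<lambda>t. adj2 (g t) ** g t) 0 t" by simp
  with mm.has_vector_derivative[OF a assms(3)]
  have z: "adj2 (g t) ** g' + adj2 g' ** g t = 0"
    using hvd_unique[OF assms(2)] by blast
  then have "(adj2 (g t) ** g' + adj2 g' ** g t) ** adj2 (g t) = 0" by (simp add: mm.zero_left)
  then have "adj2 g' = - (adj2 (g t) ** g' ** adj2 (g t))"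
    using assms(1,2) by (simp add: mm.add_left add_eq_0_iff)
  with a show "hvd (\<lambda>t. adj2 (g t)) (- (adj2 (g t) ** g' ** adj2 (g t))) t" by simp
  \<comment> \<open>The adjugate preserves traces and reverses products, so both summands of
    \<open>z\<close> have the same trace. As the sum is zero, each trace is zero.\<close>
  have "trace (adj2 g' ** g t) = trace (adj2 (g t) ** g')"
    by (simp add: trace_cmat cmat_mult_nth)
  with arg_cong[OF z, of trace] show "adj2 (g t) ** g' \<in> sl2"
    by (simp add: trace_add sl2_def trace_cmat[of 0])
qed

text \<open>No boundary values of \<open>g\<close> enter, so the lemma also applies to the extended
  gauge transformation and to a transport used as gauge. In the last claim the factor
  \<open>g 0\<close> restores the initial value 1.\<close>

lemma gauge_transform:
  assumes g: "\<And>t. t \<in> J \<Longrightarrow> g t \<in> SL2" "smooth g"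
    and \<alpha>: "\<And>t. t \<in> J \<Longrightarrow> \<alpha> t \<in> sl2" "smooth \<alpha>"
  defines "\<gamma> \<equiv> \<lambda>t. adj2 (g t) ** \<alpha> t ** g t + adj2 (g t) ** ddt L g t"
  shows "smooth \<gamma>" and "t \<in> J \<Longrightarrow> \<gamma> t \<in> sl2"
    and "t \<in> J \<Longrightarrow> hvd \<beta> (\<beta> t ** \<alpha> t - \<alpha> t ** \<beta> t) t \<Longrightarrow> \<delta> = (\<lambda>t. adj2 (g t) ** \<beta> t ** g t) \<Longrightarrow>
      hvd \<delta> (\<delta> t ** \<gamma> t - \<gamma> t ** \<delta> t) t"
    and "transport \<alpha> U \<Longrightarrow> transport \<gamma> (\<lambda>t. adj2 (g t) ** U t ** g 0)"
proof -
  show "smooth \<gamma>" unfolding \<gamma>_def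
    by (intro smooth_add smooth_mult smooth_linear[OF bounded_linear_adj2] smooth_ddt g \<alpha>)
  have d: "hvd g (ddt L g t) t" if "t \<in> J" for t using smooth_hvd g(2) that by blast
  note ad = adj2_derivative[OF g(1) _ d, simplified]
  show "\<gamma> t \<in> sl2" if "t \<in> J" for t
    using conj_sl2[OF g(1)[OF that] \<alpha>(1)[OF that]] ad(2)[of t] that
    by (simp add: \<gamma>_def sl2_def trace_add)
  show "hvd \<delta> (\<delta> t ** \<gamma> t - \<gamma> t ** \<delta> t) t"
    if t: "t \<in> J" and \<beta>: "hvd \<beta> (\<beta> t ** \<alpha> t - \<alpha> t ** \<beta> t) t"
      and \<delta>: "\<delta> = (\<lambda>t. adj2 (g t) ** \<beta> t ** g t)"
    unfolding \<delta>
    by (rule has_vector_derivative_eq_rhs,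
        rule mm.has_vector_derivative[OF mm.has_vector_derivative[OF ad(1) \<beta>] d])
      (use t g(1)[OF t] in \<open>simp_all add: \<gamma>_def mm_simps\<close>)
  show "transport \<gamma> (\<lambda>t. adj2 (g t) ** U t ** g 0)" if "transport \<alpha> U"
    unfolding transport_def
  proof (intro conjI ballI)
    show "adj2 (g 0) ** U 0 ** g 0 = mat 1" using that g(1) by (simp add: transport_def)
    fix t assume t: "t \<in> J"
    then have U: "hvd U (- (\<alpha> t ** U t)) t" using that by (simp add: transport_def)
    show "hvd (\<lambda>t. adj2 (g t) ** U t ** g 0) (- (\<gamma> t ** (adj2 (g t) ** U t ** g 0))) t"
      by (rule has_vector_derivative_eq_rhs,
          rule mm.has_vector_derivative[OF mm.has_vector_derivative[OF ad(1) U]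
            has_vector_derivative_const])
        (use t g(1)[OF t] in \<open>simp_all add: \<gamma>_def mm_simps mm.zero_right\<close>)
  qed
qed

text \<open>Invertibility takes the place of a Gronwall estimate: \<open>adj2 (U t) ** W t\<close>
  has derivative zero.\<close>

lemma transport_unique:
  assumes "transport \<alpha> U" "transport \<alpha> W" "\<And>t. t \<in> J \<Longrightarrow> \<alpha> t \<in> sl2" "t \<in> J"
  shows "U t = W t"
proof -
  have S: "\<And>t. t \<in> J \<Longrightarrow> U t \<in> SL2" using transport_SL2[OF assms(1)] assms(3) by blast
  have "hvd (\<lambda>t. adj2 (U t) ** W t) 0 t" if t: "t \<in> J" for t
  proof -
    have d: "hvd U (- (\<alpha> t ** U t)) t" "hvd W (- (\<alpha> t ** W t)) t"
      using assms(1,2) t by (simp_all add: transport_def)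
    show ?thesis
      by (rule has_vector_derivative_eq_rhs,
          rule mm.has_vector_derivative[OF adj2_derivative(1)[OF S _ d(1)] d(2)])
        (use t S[OF t] in \<open>simp_all add: mm_simps\<close>)
  qed
  from hvd_zero_const[OF this assms(4)] have "adj2 (U t) ** W t = mat 1"
    using assms(1,2) SL2_one by (simp add: transport_def)
  then have "U t ** (adj2 (U t) ** W t) = U t ** mat 1" by simp
  then show ?thesis using S[OF assms(4)] by (simp add: matrix_mul_assoc)
qed

text \<open>Using \<open>U\<close> itself as gauge turns \<alpha> into 0. In that gauge the equation
  says that the transformed \<beta> is constant.\<close>

lemma beta_transport:
  assumes p: "(\<alpha>, \<beta>) \<in> D_all L" and U: "transport \<alpha> U" and t: "t \<in> J"
  shows "\<beta> t = U t ** \<beta> 0 ** adj2 (U t)"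
proof -
  have \<alpha>: "\<And>t. t \<in> J \<Longrightarrow> \<alpha> t \<in> sl2" "smooth \<alpha>"
    and \<beta>: "\<And>t. t \<in> J \<Longrightarrow> hvd \<beta> (\<beta> t ** \<alpha> t - \<alpha> t ** \<beta> t) t"
    using p by (auto simp: D_all_iff)
  have S: "\<And>t. t \<in> J \<Longrightarrow> U t \<in> SL2" using transport_SL2[OF U] \<alpha>(1) by blast
  note sm = transport_smooth[OF U \<alpha>(2)]
  have "hvd (\<lambda>t. adj2 (U t) ** \<beta> t ** U t) 0 t" if t: "t \<in> J" for t
  proof -
    have "ddt L U t = - (\<alpha> t ** U t)"
      using U t by (intro ddt_eq) (simp_all add: transport_def)
    then show ?thesis
      using gauge_transform(3)[OF S sm \<alpha> t \<beta>[OF t] refl] S[OF t]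
      by (simp add: mm_simps mm.zero_right mm.zero_left)
  qed
  from hvd_zero_const[OF this t] have "adj2 (U t) ** \<beta> t ** U t = \<beta> 0"
    using U SL2_one by (simp add: transport_def cmat_eq_iff cmat_mult_nth)
  then have "U t ** (adj2 (U t) ** \<beta> t ** U t) ** adj2 (U t) = U t ** \<beta> 0 ** adj2 (U t)" by simp
  then show ?thesis using S[OF t] by (simp add: matrix_mul_assoc)
qed

section \<open>Gauge transformations in terms of parallel transport\<close>

lemma gauge_lift_iff:
  "g \<in> carrier (gauge_lift L) \<longleftrightarrow> g \<in> J \<rightarrow>\<^sub>E SL2 \<and> smooth g \<and>
    (\<forall>t\<in>{0, L}. g t \<in> T_C \<and> adj2 (g t) ** ddt L g t \<in> t_perp)"
  unfolding gauge_lift_def C_inf_iff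
  by (auto simp: T_C_def)

lemma gauge_act_eq:
  assumes "\<And>t. t \<in> J \<Longrightarrow> g t \<in> SL2"
  shows "gauge_act L g (\<alpha>, \<beta>) =
    (\<lambda>t\<in>J. adj2 (g t) ** \<alpha> t ** g t + adj2 (g t) ** ddt L g t, \<lambda>t\<in>J. adj2 (g t) ** \<beta> t ** g t)"
  unfolding gauge_act_def using assms by (auto intro!: restrict_ext)

lemma transport_cong:
  "(\<And>t. t \<in> J \<Longrightarrow> \<alpha> t = \<alpha>' t) \<Longrightarrow> transport \<alpha> U \<longleftrightarrow> transport \<alpha>' U"
  by (simp add: transport_def)

lemma gauge_act_transport:
  assumes p: "(\<alpha>, \<beta>) \<in> D_all L" and g: "\<And>t. t \<in> J \<Longrightarrow> g t \<in> SL2" "smooth g"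
    and U: "transport \<alpha> U"
  shows "transport (fst (gauge_act L g (\<alpha>, \<beta>))) (\<lambda>t. adj2 (g t) ** U t ** g 0)"
proof -
  have \<alpha>: "\<And>t. t \<in> J \<Longrightarrow> \<alpha> t \<in> sl2" "smooth \<alpha>" using p by (auto simp: D_all_iff)
  let ?\<gamma> = "\<lambda>t. adj2 (g t) ** \<alpha> t ** g t + adj2 (g t) ** ddt L g t"
  have "transport ?\<gamma> (\<lambda>t. adj2 (g t) ** U t ** g 0)"
    using gauge_transform(4)[OF g \<alpha> U] by simp
  moreover have "gauge_act L g (\<alpha>, \<beta>) = (restrict ?\<gamma> J, \<lambda>t\<in>J. adj2 (g t) ** \<beta> t ** g t)"
    by (rule gauge_act_eq) (rule g(1))
  ultimately show ?thesis
    using transport_cong[of "restrict ?\<gamma> J" ?\<gamma>] by simp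
qed

text \<open>The boundary hypothesis concerns the transformed \<alpha> instead of membership of
  \<open>g\<close> in the gauge group, because the extended gauge transformation takes a value
  outside the torus at \<open>L\<close>.\<close>

lemma gauge_act_D_all:
  assumes p: "(\<alpha>, \<beta>) \<in> D_all L" and g: "\<And>t. t \<in> J \<Longrightarrow> g t \<in> SL2" "smooth g"
    and bdry: "\<And>t. t \<in> {0, L} \<Longrightarrow>
      adj2 (g t) ** \<alpha> t ** g t + adj2 (g t) ** ddt L g t \<in> t_perp"
  shows "gauge_act L g (\<alpha>, \<beta>) \<in> D_all L"
proof -
  have \<alpha>: "\<And>t. t \<in> J \<Longrightarrow> \<alpha> t \<in> sl2" "smooth \<alpha>" and b: "\<And>t. t \<in> J \<Longrightarrow> \<beta> t \<in> sl2"
    and \<beta>: "\<And>t. t \<in> J \<Longrightarrow> hvd \<beta> (\<beta> t ** \<alpha> t - \<alpha> t ** \<beta> t) t"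
    using p by (auto simp: D_all_iff)
  let ?\<gamma> = "\<lambda>t. adj2 (g t) ** \<alpha> t ** g t + adj2 (g t) ** ddt L g t"
  let ?\<delta> = "\<lambda>t. adj2 (g t) ** \<beta> t ** g t"
  have G: "smooth ?\<gamma>" "\<And>t. t \<in> J \<Longrightarrow> ?\<gamma> t \<in> sl2"
    using gauge_transform(1,2)[OF g \<alpha>] by simp_all
  have "hvd ?\<delta> (?\<delta> t ** ?\<gamma> t - ?\<gamma> t ** ?\<delta> t) t" if "t \<in> J" for t
    by (rule gauge_transform(3)[OF _ g(2) _ \<alpha>(2) that \<beta>[OF that] refl]) (use g \<alpha> in auto)
  moreover have "hvd (restrict ?\<delta> J) d t \<longleftrightarrow> hvd (\<lambda>t. adj2 (g t) ** \<beta> t ** g t) d t"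
    if "t \<in> J" for t d
    by (rule hvd_cong) (use that in auto)
  moreover have "?\<delta> t \<in> sl2" if "t \<in> J" for t using conj_sl2[OF g(1) b] that by blast
  ultimately have "(restrict ?\<gamma> J, restrict ?\<delta> J) \<in> D_all L"
    unfolding D_all_iff smooth_restrict using G bdry by auto
  moreover have "gauge_act L g (\<alpha>, \<beta>) = (restrict ?\<gamma> J, restrict ?\<delta> J)"
    by (rule gauge_act_eq) (rule g(1))
  ultimately show ?thesis by simp
qed

lemma gauge_lift_determined:
  assumes p: "(\<alpha>, \<beta>) \<in> D_all L" and q: "(\<gamma>, \<delta>) \<in> D_all L"
    and U: "transport \<alpha> U" and W: "transport \<gamma> W"
    and g: "g \<in> carrier (gauge_lift L)" "gauge_act L g (\<alpha>, \<beta>) = (\<gamma>, \<delta>)"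
  shows "t \<in> J \<Longrightarrow> g t = U t ** g 0 ** adj2 (W t)"
    and "\<beta> 0 ** g 0 = g 0 ** \<delta> 0"
proof -
  have S: "\<And>t. t \<in> J \<Longrightarrow> g t \<in> SL2" and sm: "smooth g" using g(1) by (auto simp: gauge_lift_iff)
  have \<gamma>: "\<And>t. t \<in> J \<Longrightarrow> \<gamma> t \<in> sl2" using q by (auto simp: D_all_iff)
  have "transport (fst (gauge_act L g (\<alpha>, \<beta>))) (\<lambda>t. adj2 (g t) ** U t ** g 0)"
    by (rule gauge_act_transport[OF p S sm U])
  then have tr: "transport \<gamma> (\<lambda>t. adj2 (g t) ** U t ** g 0)" by (simp only: g(2) fst_conv)
  have "W t = adj2 (g t) ** U t ** g 0" if "t \<in> J" for t
    using transport_unique[OF W tr _ that] \<gamma> by blast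
  then have "g t ** W t ** adj2 (W t) = U t ** g 0 ** adj2 (W t)" if "t \<in> J" for t
    using that S[OF that] by (simp add: matrix_mul_assoc)
  moreover have "W t \<in> SL2" if "t \<in> J" for t using transport_SL2[OF W _ that] \<gamma> by blast
  ultimately show "t \<in> J \<Longrightarrow> g t = U t ** g 0 ** adj2 (W t)"
    by (metis SL2_adj2(3))
  have "\<delta> = (\<lambda>t\<in>J. adj2 (g t) ** \<beta> t ** g t)"
    using g(2) gauge_act_eq[of g \<alpha> \<beta>, OF S] by simp
  then have "\<delta> 0 = adj2 (g 0) ** \<beta> 0 ** g 0" by simp
  then show "\<beta> 0 ** g 0 = g 0 ** \<delta> 0" using S[of 0] by (simp add: matrix_mul_assoc)
qed

lemma gauge_lift_construct:
  assumes p: "(\<alpha>, \<beta>) \<in> D_all L" and q: "(\<gamma>, \<delta>) \<in> D_all L"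
    and U: "transport \<alpha> U" and W: "transport \<gamma> W"
    and D: "D \<in> T_C" "U L ** D ** adj2 (W L) \<in> T_C" "\<beta> 0 ** D = D ** \<delta> 0"
  defines "g \<equiv> \<lambda>t\<in>J. U t ** D ** adj2 (W t)"
  shows "g \<in> carrier (gauge_lift L)" and "gauge_act L g (\<alpha>, \<beta>) = (\<gamma>, \<delta>)"
proof -
  have \<alpha>: "\<And>t. t \<in> J \<Longrightarrow> \<alpha> t \<in> sl2" "smooth \<alpha>" "\<And>t. t \<in> {0, L} \<Longrightarrow> \<alpha> t \<in> t_perp"
    and \<gamma>: "\<And>t. t \<in> J \<Longrightarrow> \<gamma> t \<in> sl2" "smooth \<gamma>" "\<And>t. t \<in> {0, L} \<Longrightarrow> \<gamma> t \<in> t_perp"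
    and ext: "\<gamma> \<in> extensional J" "\<delta> \<in> extensional J"
    using p q by (auto simp: D_all_iff PiE_def)
  have SU: "\<And>t. t \<in> J \<Longrightarrow> U t \<in> SL2" and SW: "\<And>t. t \<in> J \<Longrightarrow> W t \<in> SL2"
    using transport_SL2[OF U] transport_SL2[OF W] \<alpha>(1) \<gamma>(1) by blast+
  have S: "g t \<in> SL2" if "t \<in> J" for t
    using that SU SW T_C_imp_SL2[OF D(1)] by (simp add: g_def SL2_mult SL2_adj2_closed)
  have sm: "smooth g" unfolding g_def smooth_restrict
    by (intro smooth_mult smooth_const smooth_linear[OF bounded_linear_adj2]
        transport_smooth[OF U \<alpha>(2)] transport_smooth[OF W \<gamma>(2)])
  have dg: "ddt L g t = g t ** \<gamma> t - \<alpha> t ** g t" if t: "t \<in> J" for t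
  proof -
    have d: "hvd U (- (\<alpha> t ** U t)) t" "hvd W (- (\<gamma> t ** W t)) t"
      using U W t by (simp_all add: transport_def)
    have "hvd (\<lambda>t. U t ** D ** adj2 (W t)) (g t ** \<gamma> t - \<alpha> t ** g t) t"
      by (rule has_vector_derivative_eq_rhs,
          rule mm.has_vector_derivative[OF mm.has_vector_derivative[OF d(1)
            has_vector_derivative_const] adj2_derivative(1)[OF SW _ d(2)]])
        (use t SW[OF t] in \<open>simp_all add: g_def mm_simps mm.zero_right\<close>)
    then have "hvd g (g t ** \<gamma> t - \<alpha> t ** g t) t"
      using hvd_cong[of g "\<lambda>t. U t ** D ** adj2 (W t)" t] t by (simp add: g_def)
    then show ?thesis using ddt_eq t by blast
  qed
  have gdg: "adj2 (g t) ** ddt L g t = \<gamma> t - adj2 (g t) ** \<alpha> t ** g t" if "t \<in> J" for t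
    using S[OF that] by (simp add: dg[OF that] mm_simps)
  have g0: "g 0 = D"
    using U W SL2_one by (simp add: g_def transport_def cmat_eq_iff cmat_mult_nth)
  have gL: "g L \<in> T_C" using D(2) L_pos by (simp add: g_def)
  \<comment> \<open>By \<open>gdg\<close> this is a difference of \<gamma> and a conjugate of
    \<alpha>. At the ends \<open>g\<close> lies in the torus, conjugation by which preserves
    off-diagonal matrices, so both terms are off-diagonal.\<close>
  have "adj2 (g t) ** ddt L g t \<in> t_perp" if "t \<in> {0, L}" for t
  proof -
    have "g t \<in> T_C" using that g0 gL D(1) by auto
    then show ?thesis
      using conj_t_perp[OF _ \<alpha>(3)[OF that], of "g t"] \<gamma>(3)[OF that] that gdg[of t]
      by (auto simp: t_perp_iff)
  qed
  then show "g \<in> carrier (gauge_lift L)"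
    unfolding gauge_lift_iff using S sm g0 gL D(1) by (auto simp: g_def)
  have "adj2 (g t) ** \<beta> t ** g t = \<delta> t" if t: "t \<in> J" for t
  proof -
    have "\<beta> t ** g t = U t ** (\<beta> 0 ** D) ** adj2 (W t)"
      using t SU[OF t] by (simp add: beta_transport[OF p U t] g_def matrix_mul_assoc)
    also have "\<dots> = g t ** \<delta> t"
      using t SW[OF t] by (simp add: D(3) beta_transport[OF q W t] g_def matrix_mul_assoc)
    finally have "adj2 (g t) ** (\<beta> t ** g t) = adj2 (g t) ** (g t ** \<delta> t)" by simp
    then show ?thesis using S[OF t] by (simp add: matrix_mul_assoc)
  qed
  moreover have "gauge_act L g (\<alpha>, \<beta>) = (\<lambda>t\<in>J. adj2 (g t) ** \<alpha> t ** g t + adj2 (g t) ** ddt L g t,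
      \<lambda>t\<in>J. adj2 (g t) ** \<beta> t ** g t)"
    by (rule gauge_act_eq) (rule S)
  ultimately show "gauge_act L g (\<alpha>, \<beta>) = (\<gamma>, \<delta>)"
    using ext by (auto simp: gdg extensional_def fun_eq_iff)
qed

text \<open>A relation and not a function because a transport is unconstrained outside
  \<open>J\<close>. Its value at \<open>L\<close> is unique by \<open>hol_unique\<close>, since
  transports of the same field agree on \<open>J\<close>.\<close>

definition hol :: "field_pair \<Rightarrow> cmat \<Rightarrow> cmat \<Rightarrow> bool" where
  "hol p M B \<longleftrightarrow> p \<in> D_all L \<and> (\<exists>U. transport (fst p) U \<and> U L = M) \<and> snd p 0 = B"

lemma hol_exists:
  assumes "p \<in> D_all L" obtains M B where "hol p M B" "M \<in> SL2" "B \<in> sl2"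
proof -
  obtain \<alpha> \<beta> where p: "p = (\<alpha>, \<beta>)" by fastforce
  then have \<alpha>: "\<And>t. t \<in> J \<Longrightarrow> \<alpha> t \<in> sl2" "smooth \<alpha>" "\<beta> 0 \<in> sl2"
    using assms by (auto simp: D_all_iff PiE_def Pi_iff)
  obtain U where U: "transport \<alpha> U" using transport_exists[OF \<alpha>(2)] .
  show ?thesis
    using that[of "U L" "\<beta> 0"] transport_SL2[OF U \<alpha>(1)] U \<alpha>(3) assms p
    unfolding hol_def by auto
qed

lemma gauge_lift_torus_related:
  assumes p: "hol p M B" and q: "hol q M' B'"
    and g: "g \<in> carrier (gauge_lift L)" "gauge_act L g p = q"
  obtains y where "torus_related (g 0 $ 1 $ 1) y M B M' B'" "g 0 = dg (g 0 $ 1 $ 1)"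
proof -
  obtain \<alpha> \<beta> \<gamma> \<delta> where pq: "p = (\<alpha>, \<beta>)" "q = (\<gamma>, \<delta>)" by fastforce
  obtain U W where U: "transport \<alpha> U" "U L = M" and W: "transport \<gamma> W" "W L = M'"
    using p q by (auto simp: hol_def pq)
  have D: "(\<alpha>, \<beta>) \<in> D_all L" "(\<gamma>, \<delta>) \<in> D_all L" using p q by (auto simp: hol_def pq)
  note d = gauge_lift_determined[OF D U(1) W(1) g(1) g(2)[unfolded pq]]
  have "g 0 \<in> T_C" "g L \<in> T_C" using g(1) by (auto simp: gauge_lift_iff)
  then obtain x y where x: "x \<noteq> 0" "g 0 = dg x" and y: "y \<noteq> 0" "g L = dg y"
    by (auto simp: T_C_iff)
  have "\<And>t. t \<in> J \<Longrightarrow> \<gamma> t \<in> sl2" using D(2) by (auto simp: D_all_iff)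
  then have "M' \<in> SL2" using transport_SL2[OF W(1) _ ends_in_J(2)] W(2) by blast
  then have "g L ** M' = M ** g 0" using d(1)[of L] U(2) W(2) by simp
  then have "torus_related (g 0 $ 1 $ 1) y M B M' B'"
    using d(2) x y p q by (simp add: torus_related_def hol_def pq)
  then show ?thesis using that x by simp
qed

text \<open>With \<open>gauge_lift_torus_related\<close> this identifies orbits with classes of
  holonomies. Both lemmas keep track of \<open>g 0\<close>, from which stabilizers are
  computed.\<close>

lemma torus_related_gauge_lift:
  assumes p: "hol p M B" and q: "hol q M' B'" and rel: "torus_related x y M B M' B'"
  obtains g where "g \<in> carrier (gauge_lift L)" "gauge_act L g p = q" "g 0 = dg x"
proof -
  obtain \<alpha> \<beta> \<gamma> \<delta> where pq: "p = (\<alpha>, \<beta>)" "q = (\<gamma>, \<delta>)" by fastforce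
  obtain U W where U: "transport \<alpha> U" "U L = M" and W: "transport \<gamma> W" "W L = M'"
    using p q by (auto simp: hol_def pq)
  have D: "(\<alpha>, \<beta>) \<in> D_all L" "(\<gamma>, \<delta>) \<in> D_all L" using p q by (auto simp: hol_def pq)
  have "\<And>t. t \<in> J \<Longrightarrow> \<gamma> t \<in> sl2" using D(2) by (auto simp: D_all_iff)
  then have "M' \<in> SL2" using transport_SL2[OF W(1) _ ends_in_J(2)] W(2) by blast
  then have "U L ** dg x ** adj2 (W L) = dg y"
    using rel U(2) W(2) by (simp add: torus_related_def)
  moreover have "dg x \<in> T_C" "dg y \<in> T_C" using rel by (auto simp: torus_related_def T_C_iff)
  moreover have "\<beta> 0 ** dg x = dg x ** \<delta> 0"
    using rel p q by (simp add: torus_related_def hol_def pq)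
  ultimately have "(\<lambda>t\<in>J. U t ** dg x ** adj2 (W t)) \<in> carrier (gauge_lift L)"
    "gauge_act L (\<lambda>t\<in>J. U t ** dg x ** adj2 (W t)) p = q"
    using gauge_lift_construct[OF D U(1) W(1), of "dg x"] by (simp_all add: pq)
  moreover have "(\<lambda>t\<in>J. U t ** dg x ** adj2 (W t)) 0 = dg x"
    using U(1) W(1) by (simp add: transport_def cmat_eq_iff cmat_mult_nth)
  ultimately show ?thesis using that by blast
qed

text \<open>A transformation that fixes \<open>p\<close> is its initial value conjugated by the
  transport of \<open>p\<close>, so it depends linearly on that value.\<close>

lemma stabilizer_determined:
  assumes p: "p \<in> D_all L"
    and g: "g \<in> carrier (gauge_lift L)" "gauge_act L g p = p"
    and h: "h \<in> carrier (gauge_lift L)" "gauge_act L h p = p"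
  shows "g 0 = h 0 \<Longrightarrow> g = h" and "g 0 = - h 0 \<Longrightarrow> g = (\<lambda>t\<in>J. - h t)"
proof -
  obtain \<alpha> \<beta> where pq: "p = (\<alpha>, \<beta>)" by fastforce
  then have D: "(\<alpha>, \<beta>) \<in> D_all L" using p by simp
  then obtain U where U: "transport \<alpha> U" using transport_exists by (auto simp: D_all_iff)
  note dg = gauge_lift_determined(1)[OF D D U U g(1) g(2)[unfolded pq]]
    and dh = gauge_lift_determined(1)[OF D D U U h(1) h(2)[unfolded pq]]
  have e: "g \<in> extensional J" "h \<in> extensional J"
    using g h by (auto simp: gauge_lift_iff PiE_def)
  show "g = h" if "g 0 = h 0"
    by (rule extensionalityI[OF e]) (metis dg dh that)
  show "g = (\<lambda>t\<in>J. - h t)" if "g 0 = - h 0"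
  proof (rule extensionalityI[OF e(1)])
    show "g t = (\<lambda>t\<in>J. - h t) t" if t: "t \<in> J" for t
      using dg[OF t] dh[OF t] \<open>g 0 = - h 0\<close> t by (simp add: mm.minus_left mm.minus_right)
  qed simp
qed

section \<open>The quotient by the sign\<close>


definition neg :: "(real \<Rightarrow> cmat) \<Rightarrow> real \<Rightarrow> cmat" where
  "neg g = (\<lambda>t\<in>J. - g t)"

lemma neg_0 [simp]: "neg g 0 = - g 0"
  by (simp add: neg_def)

text \<open>Makes the image in \<open>gauge_act_mod\<close> a singleton, so that
  \<open>the_elem\<close> returns the action of either representative.\<close>

lemma neg_gauge_act:
  assumes "g \<in> carrier (gauge_lift L)"
  shows "gauge_act L (neg g) p = gauge_act L g p"
proof -
  obtain \<alpha> \<beta> where p: "p = (\<alpha>, \<beta>)" by fastforce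
  have S: "\<And>t. t \<in> J \<Longrightarrow> g t \<in> SL2" and sm: "smooth g"
    using assms by (auto simp: gauge_lift_iff)
  have S': "neg g t \<in> SL2" if "t \<in> J" for t using S[OF that] that by (simp add: SL2_iff neg_def)
  have "ddt L (neg g) t = - ddt L g t" if t: "t \<in> J" for t
  proof -
    have "hvd (\<lambda>t. - g t) (- ddt L g t) t"
      by (intro has_vector_derivative_minus smooth_hvd sm t)
    then have "ddt L (\<lambda>t. - g t) t = - ddt L g t" using ddt_eq[OF t] by blast
    moreover have "ddt L (neg g) = ddt L (\<lambda>t. - g t)" by (rule ddt_cong) (simp add: neg_def)
    ultimately show ?thesis by simp
  qed
  moreover have "adj2 (- A) = - adj2 A" for A by (simp add: cmat_eq_iff)
  moreover have "gauge_act L (neg g) p = (\<lambda>t\<in>J. adj2 (neg g t) ** \<alpha> t ** neg g t + adj2 (neg g t) ** ddt L (neg g) t,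
      \<lambda>t\<in>J. adj2 (neg g t) ** \<beta> t ** neg g t)"
    unfolding p by (rule gauge_act_eq) (rule S')
  moreover have "gauge_act L g p = (\<lambda>t\<in>J. adj2 (g t) ** \<alpha> t ** g t + adj2 (g t) ** ddt L g t,
      \<lambda>t\<in>J. adj2 (g t) ** \<beta> t ** g t)"
    unfolding p by (rule gauge_act_eq) (rule S)
  ultimately show ?thesis
    by (auto intro!: restrict_ext simp: mm_simps neg_def)
qed

lemma neg_neg: "g \<in> extensional J \<Longrightarrow> neg (neg g) = g"
  by (auto simp: fun_eq_iff extensional_def neg_def)

lemma coset_sign:
  assumes "g \<in> carrier (gauge_lift L)"
  shows "{\<lambda>t\<in>J. mat 1, \<lambda>t\<in>J. - mat 1} #>\<^bsub>gauge_lift L\<^esub> g = {g, neg g}"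
proof -
  have "g \<in> extensional J" using assms by (auto simp: gauge_lift_iff PiE_def)
  then have "(\<lambda>t\<in>J. (\<lambda>t\<in>J. mat 1) t ** g t) = g" by (auto simp: fun_eq_iff extensional_def)
  moreover have "(\<lambda>t\<in>J. (\<lambda>t\<in>J. - mat 1) t ** g t) = neg g"
    by (auto intro!: restrict_ext simp: mm.minus_left neg_def)
  ultimately show ?thesis by (auto simp: r_coset_def gauge_lift_def)
qed

lemma gauge_group_carrier: "carrier (gauge_group L) = (\<lambda>g. {g, neg g}) ` carrier (gauge_lift L)"
  unfolding gauge_group_def FactGroup_def RCOSETS_def using coset_sign by auto

lemma gauge_act_mod_eq:
  "g \<in> carrier (gauge_lift L) \<Longrightarrow> gauge_act_mod L {g, neg g} p = gauge_act L g p"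
  by (simp add: gauge_act_mod_def neg_gauge_act)

lemma orbit_eq:
  "orbit (gauge_group L) (gauge_act_mod L) p = (\<lambda>g. gauge_act L g p) ` carrier (gauge_lift L)"
proof -
  have "orbit (gauge_group L) (gauge_act_mod L) p =
      (\<lambda>X. gauge_act_mod L X p) ` carrier (gauge_group L)"
    by (auto simp: orbit_def)
  also have "\<dots> = (\<lambda>g. gauge_act_mod L {g, neg g} p) ` carrier (gauge_lift L)"
    by (simp add: gauge_group_carrier image_image)
  also have "\<dots> = (\<lambda>g. gauge_act L g p) ` carrier (gauge_lift L)"
    by (rule image_cong) (simp_all add: gauge_act_mod_eq)
  finally show ?thesis .
qed

lemma stabilizer_eq:
  "stabilizer (gauge_group L) (gauge_act_mod L) p =
    (\<lambda>g. {g, neg g}) ` {g \<in> carrier (gauge_lift L). gauge_act L g p = p}"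
  unfolding stabilizer_def gauge_group_carrier using gauge_act_mod_eq[of _ p] by auto

lemma one_gauge_lift:
  shows "(\<lambda>t\<in>J. mat 1) \<in> carrier (gauge_lift L)"
    and "p \<in> D_all L \<Longrightarrow> gauge_act L (\<lambda>t\<in>J. mat 1) p = p"
proof -
  have d: "ddt L (\<lambda>t\<in>J. mat 1) t = 0" if "t \<in> J" for t
    using ddt_eq[OF that, of "\<lambda>_. mat 1" 0] ddt_cong[of "\<lambda>t\<in>J. mat 1" "\<lambda>_. mat 1"] by simp
  show "(\<lambda>t\<in>J. mat 1) \<in> carrier (gauge_lift L)"
    by (auto simp: gauge_lift_iff smooth_restrict smooth_const SL2_one d mm.zero_right t_perp_iff
        T_C_def)
  assume p: "p \<in> D_all L"
  obtain \<alpha> \<beta> where pq: "p = (\<alpha>, \<beta>)" by fastforce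
  have "\<alpha> \<in> extensional J" "\<beta> \<in> extensional J" using p by (auto simp: D_all_iff pq PiE_def)
  moreover have "gauge_act L (\<lambda>t\<in>J. mat 1) p = (\<lambda>t\<in>J. adj2 ((\<lambda>t\<in>J. mat 1) t) ** \<alpha> t ** (\<lambda>t\<in>J. mat 1) t
      + adj2 ((\<lambda>t\<in>J. mat 1) t) ** ddt L (\<lambda>t\<in>J. mat 1) t,
      \<lambda>t\<in>J. adj2 ((\<lambda>t\<in>J. mat 1) t) ** \<beta> t ** (\<lambda>t\<in>J. mat 1) t)"
    unfolding pq by (rule gauge_act_eq) (simp add: SL2_one)
  ultimately show "gauge_act L (\<lambda>t\<in>J. mat 1) p = p"
    by (auto simp: pq d extensional_def fun_eq_iff)
qed

text \<open>If \<open>x\<^sup>2 = 1\<close>, the initial value of a stabilizing transformation is 1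
  or -1, and \<open>stabilizer_determined\<close> extends this to the whole interval.\<close>

lemma stabilizer_trivial:
  assumes p: "hol p M B" and triv: "\<And>x y. torus_related x y M B M B \<Longrightarrow> x\<^sup>2 = 1"
  shows "stabilizer (gauge_group L) (gauge_act_mod L) p = {\<one>\<^bsub>gauge_group L\<^esub>}"
proof -
  have D: "p \<in> D_all L" using p by (simp add: hol_def)
  note one = one_gauge_lift(1) one_gauge_lift(2)[OF D]
  have one': "\<one>\<^bsub>gauge_group L\<^esub> = {\<lambda>t\<in>J. mat 1, neg (\<lambda>t\<in>J. mat 1)}"
    by (auto simp: gauge_group_def FactGroup_def neg_def intro!: restrict_ext)
  have "{g, neg g} = \<one>\<^bsub>gauge_group L\<^esub>"
    if g: "g \<in> carrier (gauge_lift L)" "gauge_act L g p = p" for g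
  proof -
    from gauge_lift_torus_related[OF p p g] triv have "(g 0 $ 1 $ 1)\<^sup>2 = 1" "g 0 = dg (g 0 $ 1 $ 1)"
      by metis+
    then have "g 0 = mat 1 \<or> g 0 = - mat 1"
      by (auto simp: power2_eq_1_iff cmat_eq_iff)
    then have "g = (\<lambda>t\<in>J. mat 1) \<or> g = neg (\<lambda>t\<in>J. mat 1)"
      using stabilizer_determined[OF D g one] by (auto simp: neg_def)
    then show ?thesis unfolding one' using neg_neg[of "\<lambda>t\<in>J. mat 1"] by (auto simp: doubleton_eq_iff)
  qed
  then show ?thesis unfolding stabilizer_eq using one by force
qed

text \<open>The isomorphism sends the class of \<open>g\<close> to the square of the upper left
  entry of \<open>g 0\<close>. Squaring identifies exactly the two representatives of a class, and
  complex square roots give surjectivity.\<close>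

lemma stabilizer_C_times:
  assumes p: "hol p M B" and all: "\<And>x. x \<noteq> 0 \<Longrightarrow> \<exists>y. torus_related x y M B M B"
  shows "(gauge_group L)\<lparr>carrier := stabilizer (gauge_group L) (gauge_act_mod L) p\<rparr> \<cong> C_times"
proof -
  have D: "p \<in> D_all L" using p by (simp add: hol_def)
  define St where "St = {g \<in> carrier (gauge_lift L). gauge_act L g p = p}"
  \<comment> \<open>The chosen representative is arbitrary; the square does not depend on its
    sign.\<close>
  define f :: "(real \<Rightarrow> cmat) set \<Rightarrow> complex" where "f X = ((SOME g. g \<in> X) 0 $ 1 $ 1)\<^sup>2" for X
  have f: "f {g, neg g} = (g 0 $ 1 $ 1)\<^sup>2" for g
  proof -
    have "(SOME h. h \<in> {g, neg g}) \<in> {g, neg g}" by (rule someI[of _ g]) simp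
    then show ?thesis by (auto simp: f_def)
  qed
  have St: "g 0 = dg (g 0 $ 1 $ 1)" "g 0 $ 1 $ 1 \<noteq> 0" if "g \<in> St" for g
    using gauge_lift_torus_related[OF p p, of g] that by (auto simp: St_def torus_related_def)
  have mult: "{g, neg g} \<otimes>\<^bsub>gauge_group L\<^esub> {h, neg h} = {\<lambda>t\<in>J. g t ** h t, neg (\<lambda>t\<in>J. g t ** h t)}"
    for g h
  proof -
    have "(\<lambda>t\<in>J. neg g t ** h t) = neg (\<lambda>t\<in>J. g t ** h t)"
      "(\<lambda>t\<in>J. g t ** neg h t) = neg (\<lambda>t\<in>J. g t ** h t)"
      "(\<lambda>t\<in>J. neg g t ** neg h t) = (\<lambda>t\<in>J. g t ** h t)"
      by (auto intro!: restrict_ext simp: mm.minus_left mm.minus_right neg_def)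
    then show ?thesis
      by (auto simp: gauge_group_def FactGroup_def set_mult_def gauge_lift_def)
  qed
  have "f \<in> iso ((gauge_group L)\<lparr>carrier := stabilizer (gauge_group L) (gauge_act_mod L) p\<rparr>) C_times"
  proof (rule isoI)
    show "f \<in> hom ((gauge_group L)\<lparr>carrier := stabilizer (gauge_group L) (gauge_act_mod L) p\<rparr>) C_times"
    proof (rule homI)
      fix X assume "X \<in> carrier ((gauge_group L)\<lparr>carrier := stabilizer (gauge_group L) (gauge_act_mod L) p\<rparr>)"
      then obtain g where g: "X = {g, neg g}" "g \<in> St" by (auto simp: stabilizer_eq St_def)
      then show "f X \<in> carrier C_times" using St(2) by (simp add: f C_times_def)
      fix Y assume "Y \<in> carrier ((gauge_group L)\<lparr>carrier := stabilizer (gauge_group L) (gauge_act_mod L) p\<rparr>)"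
      then obtain h where h: "Y = {h, neg h}" "h \<in> St" by (auto simp: stabilizer_eq St_def)
      have "(g 0 ** h 0) $ 1 $ 1 = g 0 $ 1 $ 1 * h 0 $ 1 $ 1"
        using St(1)[OF g(2)] by (metis add.right_neutral cmat_mult_nth dg_nth(2) mult_zero_left)
      then show "f (X \<otimes>\<^bsub>(gauge_group L)\<lparr>carrier := stabilizer (gauge_group L) (gauge_act_mod L) p\<rparr>\<^esub> Y)
          = f X \<otimes>\<^bsub>C_times\<^esub> f Y"
        using g h by (simp add: mult f C_times_def power_mult_distrib)
    qed
    show "bij_betw f (carrier ((gauge_group L)\<lparr>carrier := stabilizer (gauge_group L) (gauge_act_mod L) p\<rparr>))
        (carrier C_times)"
      unfolding bij_betw_def
    proof
      show "inj_on f (carrier ((gauge_group L)\<lparr>carrier := stabilizer (gauge_group L) (gauge_act_mod L) p\<rparr>))"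
      proof (rule inj_onI)
        fix X Y assume "X \<in> carrier ((gauge_group L)\<lparr>carrier := stabilizer (gauge_group L) (gauge_act_mod L) p\<rparr>)"
          "Y \<in> carrier ((gauge_group L)\<lparr>carrier := stabilizer (gauge_group L) (gauge_act_mod L) p\<rparr>)"
        then obtain g h where g: "X = {g, neg g}" "g \<in> St" and h: "Y = {h, neg h}" "h \<in> St"
          by (auto simp: stabilizer_eq St_def)
        assume "f X = f Y"
        then have "g 0 $ 1 $ 1 = h 0 $ 1 $ 1 \<or> g 0 $ 1 $ 1 = - h 0 $ 1 $ 1"
          by (simp add: g h f power2_eq_iff)
        moreover have "dg (- x) = - dg x" for x by (simp add: cmat_eq_iff)
        ultimately have "g 0 = h 0 \<or> g 0 = - h 0" using St(1)[OF g(2)] St(1)[OF h(2)] by metis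
        then have "g = h \<or> g = neg h"
          using stabilizer_determined[OF D, of g h] g(2) h(2) by (auto simp: St_def neg_def)
        moreover have "h \<in> extensional J" using h(2) by (auto simp: St_def gauge_lift_iff PiE_def)
        ultimately show "X = Y" using neg_neg[of h] by (auto simp: g(1) h(1))
      qed
      show "f ` carrier ((gauge_group L)\<lparr>carrier := stabilizer (gauge_group L) (gauge_act_mod L) p\<rparr>)
          = carrier C_times"
      proof (intro equalityI subsetI)
        fix z assume "z \<in> f ` carrier ((gauge_group L)\<lparr>carrier := stabilizer (gauge_group L) (gauge_act_mod L) p\<rparr>)"
        then show "z \<in> carrier C_times"
          using St(2) by (auto simp: stabilizer_eq f C_times_def St_def)
      next
        fix z assume "z \<in> carrier C_times"
        then have "csqrt z \<noteq> 0" by (simp add: C_times_def)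
        then obtain y where "torus_related (csqrt z) y M B M B" using all by blast
        from torus_related_gauge_lift[OF p p this] obtain g
          where g: "g \<in> carrier (gauge_lift L)" "gauge_act L g p = p" "g 0 = dg (csqrt z)" .
        then have "f {g, neg g} = z" by (simp add: f)
        moreover have "{g, neg g} \<in> stabilizer (gauge_group L) (gauge_act_mod L) p"
          using g by (auto simp: stabilizer_eq)
        ultimately show "z \<in> f ` carrier ((gauge_group L)\<lparr>carrier := stabilizer (gauge_group L) (gauge_act_mod L) p\<rparr>)"
          by (force simp del: csqrt_eq_0)
      qed
    qed
  qed
  then show ?thesis by (auto simp: is_iso_def)
qed

end

section \<open>The torus action on holonomies\<close>

lemma mat_exp_sigma_x: "mat_exp (z *\<^sub>m sigma_x) = mat2 (cosh z) (sinh z) (sinh z) (cosh z)"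
proof -
  \<comment> \<open>The spectral projections of \<open>sigma_x\<close> for the eigenvalues 1 and -1,
    so that powers and the exponential act on scalars.\<close>
  let ?P = "mat2 (1/2) (1/2) (1/2) (1/2)" and ?Q = "mat2 (1/2) (-1/2) (-1/2) (1/2)"
  have pow: "((\<lambda>B. (z *\<^sub>m sigma_x) ** B) ^^ n) (mat 1) = z ^ n *\<^sub>m ?P + (- z) ^ n *\<^sub>m ?Q" for n
    by (induction n) (simp_all add: sigma_x_def mat2_arith mat2_mult field_simps)
  have "(\<lambda>n. (w ^ n /\<^sub>R fact n) *\<^sub>m A) sums (exp w *\<^sub>m A)" for w A
    by (rule bounded_linear.sums[OF bounded_linear_smult_mat exp_converges])
  then have "(\<lambda>n. (z ^ n /\<^sub>R fact n) *\<^sub>m ?P + ((- z) ^ n /\<^sub>R fact n) *\<^sub>m ?Q)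
      sums (exp z *\<^sub>m ?P + exp (- z) *\<^sub>m ?Q)"
    by (intro sums_add)
  moreover have "(z ^ n /\<^sub>R fact n) *\<^sub>m ?P + ((- z) ^ n /\<^sub>R fact n) *\<^sub>m ?Q =
      (1 / fact n) *\<^sub>R ((\<lambda>B. (z *\<^sub>m sigma_x) ** B) ^^ n) (mat 1)" for n
    unfolding pow by (simp add: cmat_eq_iff scaleR_conv_of_real[where 'a = complex] field_simps)
  ultimately have "mat_exp (z *\<^sub>m sigma_x) = exp z *\<^sub>m ?P + exp (- z) *\<^sub>m ?Q"
    unfolding mat_exp_def by (simp add: sums_iff)
  then show ?thesis
    by (simp add: mat2_arith cosh_def sinh_def scaleR_conv_of_real[where 'a = complex] field_simps)
qed

lemma torus_related_mat2:
  "torus_related x y (mat2 p q r s) (mat2 a b c d) (mat2 p' q' r' s') (mat2 a' b' c' d') \<longleftrightarrow>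
    x \<noteq> 0 \<and> y \<noteq> 0 \<and> p * x = y * p' \<and> q = x * y * q' \<and> r * x * y = r' \<and> s * y = x * s' \<and>
    a = a' \<and> b = x\<^sup>2 * b' \<and> c * x\<^sup>2 = c' \<and> d = d'"
  by (auto simp: torus_related_def dg_def mat2_mult field_simps power2_eq_square)

lemma dg_mult: "dg a ** dg b = dg (a * b)"
  by (simp add: dg_def mat2_mult)

lemma dg_one [simp]: "dg 1 = mat 1"
  by (simp add: cmat_eq_iff)

text \<open>The form needed for uniqueness: two representatives of an orbit are compared through a
  common starting pair.\<close>

lemma torus_related_trans:
  assumes "torus_related x y M B M1 B1" "torus_related x' y' M B M2 B2"
  shows "torus_related (x' / x) (y' / y) M1 B1 M2 B2"
proof -
  have nz: "x \<noteq> 0" "y \<noteq> 0" "x' \<noteq> 0" "y' \<noteq> 0" using assms by (auto simp: torus_related_def)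
  \<comment> \<open>Proved for two independent torus elements, so that it covers \<open>M\<close>
    with \<open>x, y\<close> and \<open>B\<close> with \<open>x, x\<close>.\<close>
  have *: "N1 ** dg (u' / u) = dg (v' / v) ** N2"
    if "u \<noteq> 0" "v \<noteq> 0" "N ** dg u = dg v ** N1" "N ** dg u' = dg v' ** N2" for u v u' v' N N1 N2
  proof -
    have "N1 ** dg (u' / u) = dg (inverse v) ** (dg v ** N1) ** dg (u' / u)"
      using that by (simp add: matrix_mul_assoc dg_mult)
    also have "\<dots> = dg (inverse v) ** N ** (dg u ** dg (u' / u))"
      by (simp only: that(3)[symmetric] matrix_mul_assoc)
    also have "\<dots> = dg (inverse v) ** (N ** dg u')"
      using that(1) by (simp add: dg_mult matrix_mul_assoc)
    also have "\<dots> = dg (inverse v) ** (dg v' ** N2)"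
      by (simp only: that(4))
    also have "\<dots> = dg (v' / v) ** N2"
      by (simp add: matrix_mul_assoc dg_mult divide_inverse mult.commute)
    finally show ?thesis .
  qed
  show ?thesis
    using nz *[of x y M M1 x' y' M2] *[of x x B B1 x' x' B2] assms by (simp add: torus_related_def)
qed

lemma torus_related_zero_iff:
  assumes "torus_related x y M B M' B'"
  shows "M$1$1 = 0 \<longleftrightarrow> M'$1$1 = 0" "M$1$2 = 0 \<longleftrightarrow> M'$1$2 = 0"
    "M$2$1 = 0 \<longleftrightarrow> M'$2$1 = 0" "M$2$2 = 0 \<longleftrightarrow> M'$2$2 = 0"
  using assms unfolding torus_related_def
  by (auto simp: cmat_eq_iff cmat_mult_nth)

text \<open>\<open>dg x\<close> is then 1 or -1, and conjugation by it is trivial.\<close>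

lemma torus_related_square_one:
  assumes "torus_related x y M B M' B'" "x\<^sup>2 = 1"
  shows "B = B'"
  using assms unfolding torus_related_def
  by (auto simp: cmat_eq_iff cmat_mult_nth power2_eq_1_iff)

text \<open>A fundamental domain for the group generated by negation and translation by
  \<open>2 * pi * \<i>\<close>, under which \<^const>\<open>cosh\<close> is invariant;
  the preimages of 1 and -1 are left out.\<close>

definition cosh_domain :: "complex \<Rightarrow> bool" where
  "cosh_domain z \<longleftrightarrow> 0 \<le> Im z \<and> Im z \<le> pi \<and> (Im z = 0 \<or> Im z = pi \<longrightarrow> 0 < Re z)"

lemma cosh_domain_inj:
  assumes z: "cosh_domain z" and w: "cosh_domain w" and eq: "cosh z = cosh w"
  shows "z = w"
proof -
  from eq have "cos (\<i> * z) = cos (\<i> * w)" by (simp add: cosh_conv_cos)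
  then obtain m where "m \<in> \<int>" and m: "\<i> * z = \<i> * w + of_real (2 * m * pi) \<or> \<i> * z = - (\<i> * w) + of_real (2 * m * pi)"
    unfolding complex_cos_eq by auto
  then obtain n :: int where n: "m = of_int n" by (auto elim: Ints_cases)
  \<comment> \<open>Imaginary parts in \<open>[0, pi]\<close> leave only shifts by at most one
    period in either direction.\<close>
  have rng: "- (2 * pi) \<le> 2 * of_int n * pi \<Longrightarrow> 2 * of_int n * pi \<le> 2 * pi \<Longrightarrow> n = -1 \<or> n = 0 \<or> n = 1"
  proof -
    assume "- (2 * pi) \<le> 2 * of_int n * pi" "2 * of_int n * pi \<le> 2 * pi"
    then have "-1 * pi \<le> of_int n * pi" "of_int n * pi \<le> 1 * pi" by (simp_all add: mult_ac)
    then have "-1 \<le> (of_int n :: real)" "(of_int n :: real) \<le> 1"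
      using pi_gt_zero by (simp_all only: mult_le_cancel_right_pos)
    then show ?thesis by linarith
  qed
  have zb: "0 \<le> Im z" "Im z \<le> pi" "0 \<le> Im w" "Im w \<le> pi"
    using z w by (simp_all add: cosh_domain_def)
  from m show ?thesis
  proof
    assume h: "\<i> * z = \<i> * w + of_real (2 * m * pi)"
    from arg_cong[OF h, of Re] arg_cong[OF h, of Im]
    have e: "Im w = Im z + 2 * of_int n * pi" "Re z = Re w" by (simp_all add: n)
    then have "n = -1 \<or> n = 0 \<or> n = 1"
      using zb pi_gt_zero by (intro rng; linarith)
    then have "n = 0" using e zb pi_gt_zero by (elim disjE; simp; linarith)
    then show ?thesis using e by (simp add: complex_eq_iff)
  next
    \<comment> \<open>Here the imaginary parts of \<open>z\<close> and \<open>w\<close> add up to a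
      multiple of 2 pi, so both are 0 or both are pi. Then both real parts are positive, whereas
      they are opposite.\<close>
    assume h: "\<i> * z = - (\<i> * w) + of_real (2 * m * pi)"
    from arg_cong[OF h, of Re] arg_cong[OF h, of Im]
    have e: "- Im z = Im w + 2 * of_int n * pi" "Re z = - Re w" by (simp_all add: n)
    then have "n = -1 \<or> n = 0 \<or> n = 1"
      using zb pi_gt_zero by (intro rng; linarith)
    then show ?thesis using e z w pi_gt_zero by (auto simp: cosh_domain_def)
  qed
qed

text \<open>The only zeros of \<open>sinh\<close> in the strip are 0 and i pi, which the condition
  on the real part removes. This keeps the denominators of item (i) away from zero.\<close>

lemma cosh_domain_sinh:
  assumes "cosh_domain z" shows "sinh z \<noteq> 0"
proof
  assume "sinh z = 0"
  then have "sin (\<i> * z) = 0" by (simp add: sinh_conv_sin)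
  then obtain n :: int where n: "\<i> * z = of_real (of_int n * pi)" unfolding sin_eq_0 by auto
  from arg_cong[OF n, of Re] arg_cong[OF n, of Im]
  have e: "Im z = - (of_int n * pi)" "Re z = 0" by simp_all
  then have "-1 * pi \<le> of_int n * pi" "of_int n * pi \<le> 0 * pi"
    using assms by (auto simp: cosh_domain_def)
  then have "-1 \<le> (of_int n :: real)" "(of_int n :: real) \<le> 0"
    using pi_gt_zero by (simp_all only: mult_le_cancel_right_pos)
  then have "n = -1 \<or> n = 0" by linarith
  then show False using e assms by (auto simp: cosh_domain_def)
qed

lemma cosh_domain_surj:
  assumes "k \<noteq> 1" "k \<noteq> -1"
  obtains z where "cosh_domain z" "cosh z = k"
proof -
  have neg: "cosh (- z) = cosh z" for z :: complex by simp
  \<comment> \<open>\<open>Arccos\<close> already bounds the imaginary part of \<open>z0\<close> by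
    pi in absolute value; negation then brings it into the strip.\<close>
  define z0 where "z0 = - \<i> * Arccos k"
  have z0: "cosh z0 = k" by (simp add: z0_def cosh_conv_cos mult.assoc[symmetric])
  have "\<bar>Im z0\<bar> \<le> pi" using Re_Arccos_bound[of k] by (simp add: z0_def)
  then obtain z1 where z1: "cosh z1 = k" "0 \<le> Im z1" "Im z1 \<le> pi"
    using z0 neg[of z0] that by (cases "Im z0 \<ge> 0") (metis abs_of_nonneg, metis abs_of_neg
        abs_ge_zero not_le uminus_complex.simps(2))
  consider "0 < Im z1" "Im z1 < pi" | "Im z1 = 0" | "Im z1 = pi" using z1 by linarith
  then show ?thesis
  proof cases
    case 1
    then show ?thesis using that[of z1] z1 by (simp add: cosh_domain_def)
  next
    case 2
    have "Re z1 \<noteq> 0"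
    proof
      assume "Re z1 = 0"
      then have "z1 = 0" using 2 by (simp add: complex_eq_iff)
      then show False using z1 assms by simp
    qed
    then consider "0 < Re z1" | "0 < Re (- z1)" by fastforce
    then show ?thesis
    proof cases
      case 1
      then show ?thesis using that[of z1] z1 2 by (simp add: cosh_domain_def)
    next
      case 2
      then show ?thesis using that[of "- z1"] z1 \<open>Im z1 = 0\<close> by (simp add: cosh_domain_def)
    qed
  next
    case 3
    have "Re z1 \<noteq> 0"
    proof
      assume "Re z1 = 0"
      then have "z1 = \<i> * of_real pi" using 3 by (simp add: complex_eq_iff)
      then have "\<i> * z1 = - of_real pi" by (simp add: mult.assoc[symmetric])
      then have "cosh z1 = -1" by (simp add: cosh_conv_cos flip: cos_of_real)
      then show False using z1 assms by simp
    qed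
    then consider "0 < Re z1" | "0 < - Re z1" by fastforce
    then show ?thesis
    proof cases
      case 1
      then show ?thesis using that[of z1] z1 3 by (simp add: cosh_domain_def)
    next
      case 2
      \<comment> \<open>Negation followed by the translation by 2 pi i maps the line of imaginary
        part pi to itself and reverses the sign of the real part.\<close>
      let ?z = "- z1 + 2 * of_real pi * \<i>"
      have "cosh ?z = cosh z1"
        by (simp add: cosh_def exp_add exp_diff exp_minus inverse_eq_divide)
      then show ?thesis using that[of ?z] z1 3 2 by (simp add: cosh_domain_def)
    qed
  qed
qed

section \<open>Holonomies of the normal forms\<close>

definition pair_i :: "real \<Rightarrow> complex \<Rightarrow> complex \<Rightarrow> complex \<Rightarrow> complex \<Rightarrow> field_pair" where
  "pair_i L \<alpha>0 \<beta>x \<xi>0 \<xi>L =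
     (\<lambda>t\<in>{0..L}. \<alpha>0 *\<^sub>m sigma_x,
       \<lambda>t\<in>{0..L}. \<beta>x *\<^sub>m sigma_x
         + ((- \<xi>0 * cosh (2 * \<alpha>0 * of_real (L - t)) + \<xi>L * cosh (2 * \<alpha>0 * of_real t))
             / sinh (2 * \<alpha>0 * of_real L)) *\<^sub>m sigma_y
         + (- \<i> * ((\<xi>0 * sinh (2 * \<alpha>0 * of_real (L - t)) + \<xi>L * sinh (2 * \<alpha>0 * of_real t))
             / sinh (2 * \<alpha>0 * of_real L))) *\<^sub>m sigma_z)"

definition pair_ii :: "real \<Rightarrow> complex \<Rightarrow> complex \<Rightarrow> complex \<Rightarrow> field_pair" where
  "pair_ii L \<xi>0 \<xi>L c =
     (\<lambda>t\<in>{0..L}. mat2 0 (1 / of_real L) 0 0,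
       \<lambda>t\<in>{0..L}. (- (\<i> / of_real L)) *\<^sub>m mat2
         (\<xi>0 * of_real (L - t) + \<xi>L * of_real t)
         (\<xi>L * of_real (L + t\<^sup>2 / L) - \<xi>0 * of_real ((L - t)\<^sup>2 / L) + c)
         ((\<xi>0 - \<xi>L) * of_real L)
         (- \<xi>0 * of_real (L - t) - \<xi>L * of_real t))"

definition pair_iii :: "real \<Rightarrow> complex \<Rightarrow> complex \<Rightarrow> complex \<Rightarrow> field_pair" where
  "pair_iii L \<xi>0 \<xi>L c =
     (\<lambda>t\<in>{0..L}. mat2 0 0 (1 / of_real L) 0,
       \<lambda>t\<in>{0..L}. (- (\<i> / of_real L)) *\<^sub>m mat2
         (\<xi>0 * of_real (L - t) + \<xi>L * of_real t)
         (- (\<xi>0 - \<xi>L) * of_real L)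
         (\<xi>0 * of_real ((L - t)\<^sup>2 / L) - \<xi>L * of_real (L + t\<^sup>2 / L) + c)
         (- \<xi>0 * of_real (L - t) - \<xi>L * of_real t))"

text \<open>The off-diagonal entries are arbitrary; \<open>reduced_vi\<close> later selects the
  displayed ones.\<close>

definition pair_vi :: "real \<Rightarrow> complex \<Rightarrow> complex \<Rightarrow> complex \<Rightarrow> field_pair" where
  "pair_vi L \<xi>0 b c = (\<lambda>t\<in>{0..L}. 0, \<lambda>t\<in>{0..L}. mat2 (- \<i> * \<xi>0) b c (\<i> * \<xi>0))"

text \<open>The value at 0 of the coefficient of \<open>sigma_y\<close> in item (i). Its dependence
  on \<xi>L is what lets \<xi>L be recovered from \<open>B\<close>.\<close>

definition y_i :: "real \<Rightarrow> complex \<Rightarrow> complex \<Rightarrow> complex \<Rightarrow> complex" where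
  "y_i L \<alpha>0 \<xi>0 \<xi>L = (- \<xi>0 * cosh (2 * \<alpha>0 * of_real L) + \<xi>L) / sinh (2 * \<alpha>0 * of_real L)"

context interval
begin

lemma L_neq_0 [simp]: "L \<noteq> 0" "complex_of_real L \<noteq> 0"
  using L_pos by simp_all

text \<open>One verification for every displayed constant \<alpha>. The derivative hypotheses are
  the entries of the equations for \<beta> and for the transport. Entries are functions of a complex
  variable, so that the rules for complex derivatives apply, and are then restricted to real
  \<open>t\<close>.\<close>

lemma hol_off_diagonal:
  fixes A B C P Q R S :: "complex \<Rightarrow> complex"
  assumes A: "\<And>z. (A has_field_derivative B z * v - u * C z) (at z)"
    and B: "\<And>z. (B has_field_derivative 2 * A z * u) (at z)"
    and C: "\<And>z. (C has_field_derivative - 2 * A z * v) (at z)"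
    and P: "\<And>z. (P has_field_derivative - u * R z) (at z)"
    and Q: "\<And>z. (Q has_field_derivative - u * S z) (at z)"
    and R: "\<And>z. (R has_field_derivative - v * P z) (at z)"
    and S: "\<And>z. (S has_field_derivative - v * Q z) (at z)"
    and init: "P 0 = 1" "Q 0 = 0" "R 0 = 0" "S 0 = 1"
    and p: "fst p = (\<lambda>t\<in>J. mat2 0 u v 0)"
      "snd p = (\<lambda>t\<in>J. mat2 (A (of_real t)) (B (of_real t)) (C (of_real t)) (- A (of_real t)))"
  shows "hol p (mat2 (P L) (Q L) (R L) (S L)) (mat2 (A 0) (B 0) (C 0) (- A 0))"
proof -
  note der = has_vector_derivative_real_field
  let ?\<beta> = "\<lambda>t. mat2 (A (of_real t)) (B (of_real t)) (C (of_real t)) (- A (of_real t))"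
  let ?U = "\<lambda>t::real. mat2 (P (of_real t)) (Q (of_real t)) (R (of_real t)) (S (of_real t))"
  have \<beta>: "hvd (snd p) (snd p t ** fst p t - fst p t ** snd p t) t" if t: "t \<in> J" for t
  proof -
    have "hvd ?\<beta> (mat2 (B (of_real t) * v - u * C (of_real t)) (2 * A (of_real t) * u)
        (- 2 * A (of_real t) * v) (- (B (of_real t) * v - u * C (of_real t)))) t"
      by (intro has_vector_derivative_mat2 der has_vector_derivative_minus A B C)
    moreover have "hvd (snd p) d t \<longleftrightarrow> hvd ?\<beta> d t" for d
      by (rule hvd_cong) (use t p in auto)
    ultimately show ?thesis
      using t by (simp add: p mat2_mult mat2_arith algebra_simps)
  qed
  have "transport (fst p) ?U"
    unfolding transport_def
  proof (intro conjI ballI)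
    fix t assume t: "t \<in> J"
    have "hvd ?U (mat2 (- u * R (of_real t)) (- u * S (of_real t)) (- v * P (of_real t)) (- v * Q (of_real t))) t"
      by (intro has_vector_derivative_mat2 der P Q R S)
    then show "hvd ?U (- (fst p t ** ?U t)) t"
      using t by (simp add: p mat2_mult mat2_arith)
  qed (simp add: init mat2_arith)
  moreover have "smooth (fst p)" unfolding p smooth_restrict by (rule smooth_const)
  moreover have "fst p \<in> J \<rightarrow>\<^sub>E sl2" "snd p \<in> J \<rightarrow>\<^sub>E sl2" by (auto simp: p sl2_iff)
  moreover have "fst p t \<in> t_perp" if "t \<in> {0, L}" for t using that by (auto simp: p t_perp_iff)
  ultimately have "p \<in> D_all L"
    using \<beta> D_all_iff[of "fst p" "snd p"] by simp
  then show ?thesis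
    unfolding hol_def using \<open>transport (fst p) ?U\<close> by (auto simp: p)
qed

lemma hol_i:
  assumes s: "sinh (2 * a * of_real L) \<noteq> 0"
  shows "hol (pair_i L a \<beta>x \<xi>0 \<xi>L)
    (mat2 (cosh (a * L)) (- sinh (a * L)) (- sinh (a * L)) (cosh (a * L)))
    (mat2 (- \<i> * \<xi>0) (\<beta>x - \<i> * y_i L a \<xi>0 \<xi>L) (\<beta>x + \<i> * y_i L a \<xi>0 \<xi>L) (\<i> * \<xi>0))"
proof -
  let ?s = "sinh (2 * a * of_real L)"
  \<comment> \<open>The coefficients of \<open>sigma_z\<close> and \<open>sigma_y\<close> continued
    to complex \<open>t\<close>. They form a closed linear system, while the part along
    \<open>sigma_x\<close> commutes with \<alpha> and stays constant.\<close>
  define X where "X z = - \<i> * ((\<xi>0 * sinh (2 * a * (of_real L - z)) + \<xi>L * sinh (2 * a * z)) / ?s)" for z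
  define Y where "Y z = (- \<xi>0 * cosh (2 * a * (of_real L - z)) + \<xi>L * cosh (2 * a * z)) / ?s" for z
  have X: "(X has_field_derivative - 2 * \<i> * a * Y z) (at z)" for z
    unfolding X_def[abs_def] Y_def using s
    by (auto intro!: derivative_eq_intros simp: divide_simps) (simp add: algebra_simps)
  have Y: "(Y has_field_derivative 2 * \<i> * a * X z) (at z)" for z
    unfolding Y_def[abs_def] X_def using s
    by (auto intro!: derivative_eq_intros simp: divide_simps) (simp add: algebra_simps)
  have "hol (pair_i L a \<beta>x \<xi>0 \<xi>L)
      (mat2 (cosh (a * of_real L)) (- sinh (a * of_real L)) (- sinh (a * of_real L)) (cosh (a * of_real L)))
      (mat2 (X 0) (\<beta>x - \<i> * Y 0) (\<beta>x + \<i> * Y 0) (- X 0))"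
  proof (rule hol_off_diagonal[where A = X and B = "\<lambda>z. \<beta>x - \<i> * Y z" and C = "\<lambda>z. \<beta>x + \<i> * Y z"
        and u = a and v = a and P = "\<lambda>z. cosh (a * z)" and Q = "\<lambda>z. - sinh (a * z)"
        and R = "\<lambda>z. - sinh (a * z)" and S = "\<lambda>z. cosh (a * z)"])
    show "(X has_field_derivative (\<beta>x - \<i> * Y z) * a - a * (\<beta>x + \<i> * Y z)) (at z)" for z
      using X[of z] by (simp add: algebra_simps)
    show "((\<lambda>z. \<beta>x - \<i> * Y z) has_field_derivative 2 * X z * a) (at z)" for z
      by (rule derivative_eq_intros Y refl | simp add: algebra_simps)+
    show "((\<lambda>z. \<beta>x + \<i> * Y z) has_field_derivative - 2 * X z * a) (at z)" for z
      by (rule derivative_eq_intros Y refl | simp add: algebra_simps)+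
    have "snd (pair_i L a \<beta>x \<xi>0 \<xi>L) =
        (\<lambda>t\<in>J. \<beta>x *\<^sub>m sigma_x + Y (of_real t) *\<^sub>m sigma_y + X (of_real t) *\<^sub>m sigma_z)"
      by (simp add: pair_i_def X_def Y_def)
    then show "snd (pair_i L a \<beta>x \<xi>0 \<xi>L) = (\<lambda>t\<in>J. mat2 (X (of_real t)) (\<beta>x - \<i> * Y (of_real t))
        (\<beta>x + \<i> * Y (of_real t)) (- X (of_real t)))"
      by (auto intro!: restrict_ext simp: cmat_eq_iff sigma_x_def sigma_y_def sigma_z_def)
  qed (auto intro!: derivative_eq_intros restrict_ext simp: pair_i_def cmat_eq_iff sigma_x_def)
  moreover have "X 0 = - \<i> * \<xi>0" "Y 0 = y_i L a \<xi>0 \<xi>L"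
    using s by (simp_all add: X_def Y_def y_i_def)
  ultimately show ?thesis by simp
qed

text \<open>Here \<alpha> is nilpotent, so its transport is linear, namely 1 - t \<alpha>, and the
  entries of \<beta> are polynomials of degree at most two.\<close>

lemma hol_ii:
  "hol (pair_ii L \<xi>0 \<xi>L c) (mat2 1 (-1) 0 1)
    (mat2 (- \<i> * \<xi>0) (- (\<i> / of_real L) * ((\<xi>L - \<xi>0) * of_real L + c)) (- \<i> * (\<xi>0 - \<xi>L)) (\<i> * \<xi>0))"
proof -
  let ?k = "- (\<i> / of_real L)"
  define A where "A z = ?k * (\<xi>0 * (of_real L - z) + \<xi>L * z)" for z
  define B where "B z = ?k * (\<xi>L * (of_real L + z\<^sup>2 / of_real L) - \<xi>0 * ((of_real L - z)\<^sup>2 / of_real L) + c)" for z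
  have "hol (pair_ii L \<xi>0 \<xi>L c)
      (mat2 1 (- of_real L / of_real L) 0 1) (mat2 (A 0) (B 0) (?k * ((\<xi>0 - \<xi>L) * of_real L)) (- A 0))"
  proof (rule hol_off_diagonal[where A = A and B = B and C = "\<lambda>z. ?k * ((\<xi>0 - \<xi>L) * of_real L)"
        and u = "1 / of_real L" and v = 0 and P = "\<lambda>z. 1" and Q = "\<lambda>z. - z / of_real L"
        and R = "\<lambda>z. 0" and S = "\<lambda>z. 1"])
    show "(A has_field_derivative B z * 0 - 1 / of_real L * (?k * ((\<xi>0 - \<xi>L) * of_real L))) (at z)" for z
      unfolding A_def[abs_def]
      by (auto intro!: derivative_eq_intros simp: divide_simps) (simp add: algebra_simps)
    show "(B has_field_derivative 2 * A z * (1 / of_real L)) (at z)" for z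
      unfolding A_def B_def[abs_def]
      by (auto intro!: derivative_eq_intros simp: divide_simps) (simp add: algebra_simps)
  qed (auto intro!: derivative_eq_intros restrict_ext
      simp: pair_ii_def cmat_eq_iff A_def B_def algebra_simps)
  moreover have "A 0 = - \<i> * \<xi>0" "B 0 = ?k * ((\<xi>L - \<xi>0) * of_real L + c)"
    by (simp_all add: A_def B_def power2_eq_square algebra_simps)
  ultimately show ?thesis by simp
qed

lemma hol_iii:
  "hol (pair_iii L \<xi>0 \<xi>L c) (mat2 1 0 (-1) 1)
    (mat2 (- \<i> * \<xi>0) (\<i> * (\<xi>0 - \<xi>L)) (- (\<i> / of_real L) * ((\<xi>0 - \<xi>L) * of_real L + c)) (\<i> * \<xi>0))"
proof -
  let ?k = "- (\<i> / of_real L)"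
  define A where "A z = ?k * (\<xi>0 * (of_real L - z) + \<xi>L * z)" for z
  define C where "C z = ?k * (\<xi>0 * ((of_real L - z)\<^sup>2 / of_real L) - \<xi>L * (of_real L + z\<^sup>2 / of_real L) + c)" for z
  have "hol (pair_iii L \<xi>0 \<xi>L c)
      (mat2 1 0 (- of_real L / of_real L) 1) (mat2 (A 0) (?k * (- (\<xi>0 - \<xi>L) * of_real L)) (C 0) (- A 0))"
  proof (rule hol_off_diagonal[where A = A and C = C and B = "\<lambda>z. ?k * (- (\<xi>0 - \<xi>L) * of_real L)"
        and v = "1 / of_real L" and u = 0 and P = "\<lambda>z. 1" and R = "\<lambda>z. - z / of_real L"
        and Q = "\<lambda>z. 0" and S = "\<lambda>z. 1"])
    show "(A has_field_derivative (?k * (- (\<xi>0 - \<xi>L) * of_real L)) * (1 / of_real L) - 0 * C z) (at z)" for z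
      unfolding A_def[abs_def]
      by (auto intro!: derivative_eq_intros simp: divide_simps)
    show "(C has_field_derivative - 2 * A z * (1 / of_real L)) (at z)" for z
      unfolding A_def C_def[abs_def]
      by (auto intro!: derivative_eq_intros simp: divide_simps) (simp add: algebra_simps)
  qed (auto intro!: derivative_eq_intros restrict_ext
      simp: pair_iii_def cmat_eq_iff A_def C_def algebra_simps)
  moreover have "A 0 = - \<i> * \<xi>0" "C 0 = ?k * ((\<xi>0 - \<xi>L) * of_real L + c)"
    by (simp_all add: A_def C_def power2_eq_square algebra_simps)
  moreover have "?k * (- (\<xi>0 - \<xi>L) * of_real L) = \<i> * (\<xi>0 - \<xi>L)"
    by (simp add: algebra_simps)
  ultimately show ?thesis by (simp only:) simp
qed

lemma hol_vi:
  "hol (pair_vi L \<xi>0 b c) (mat2 1 0 0 1) (mat2 (- \<i> * \<xi>0) b c (\<i> * \<xi>0))"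
  using hol_off_diagonal[of "\<lambda>_. - \<i> * \<xi>0" "\<lambda>_. b" 0 0 "\<lambda>_. c" "\<lambda>_. 1" "\<lambda>_. 0" "\<lambda>_. 0" "\<lambda>_. 1"
      "pair_vi L \<xi>0 b c"]
  by (simp add: pair_vi_def mat2_arith)

section \<open>The extended gauge transformation and its effect on holonomies\<close>

lemma ext_gauge_eq:
  assumes "t \<in> J"
  shows "ext_gauge L t = (let z = \<i> * of_real pi / (2 * of_real L) * of_real t in
    mat2 (cosh z) (sinh z) (sinh z) (cosh z))"
  using assms by (simp add: ext_gauge_def mat_exp_sigma_x Let_def mult.assoc)

lemma ext_gauge_ends: "ext_gauge L 0 = mat 1" "ext_gauge L L = mat2 0 \<i> \<i> 0"
proof -
  show "ext_gauge L 0 = mat 1" by (simp add: ext_gauge_eq mat2_arith)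
  have "cosh (\<i> * of_real pi / 2) = 0" "sinh (\<i> * of_real pi / 2) = \<i>"
    unfolding cosh_conv_cos sinh_conv_sin by (simp_all add: mult.assoc[symmetric])
  then show "ext_gauge L L = mat2 0 \<i> \<i> 0" by (simp add: ext_gauge_eq)
qed

lemma ext_gauge_SL2: "t \<in> J \<Longrightarrow> ext_gauge L t \<in> SL2"
  using cosh_square_eq[where 'a = complex]
  by (simp add: ext_gauge_eq SL2_iff Let_def power2_eq_square[symmetric] cosh_square_eq)

lemma ext_gauge_hvd:
  assumes t: "t \<in> J"
  shows "hvd (ext_gauge L) (ext_gauge L t ** ((\<i> * of_real pi / (2 * of_real L)) *\<^sub>m sigma_x)) t"
proof -
  define k where "k = \<i> * complex_of_real pi / (2 * of_real L)"
  have "hvd (\<lambda>t. mat2 (cosh (k * of_real t)) (sinh (k * of_real t)) (sinh (k * of_real t)) (cosh (k * of_real t)))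
      (mat2 (sinh (k * of_real t) * k) (cosh (k * of_real t) * k)
        (cosh (k * of_real t) * k) (sinh (k * of_real t) * k)) t"
    by (intro has_vector_derivative_mat2 has_vector_derivative_real_field[where f = "\<lambda>z. cosh (k * z)"]
        has_vector_derivative_real_field[where f = "\<lambda>z. sinh (k * z)"])
      (auto intro!: derivative_eq_intros)
  moreover have "hvd (ext_gauge L) d t \<longleftrightarrow> hvd (\<lambda>t. mat2 (cosh (k * of_real t)) (sinh (k * of_real t))
      (sinh (k * of_real t)) (cosh (k * of_real t))) d t" for d
    by (rule hvd_cong) (use t ext_gauge_eq in \<open>auto simp: k_def Let_def\<close>)
  ultimately show ?thesis
    using t by (simp add: ext_gauge_eq k_def[symmetric] Let_def sigma_x_def mat2_arith mat2_mult)
qed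

lemma ext_gauge_smooth: "smooth (ext_gauge L)"
  using smooth_linear_ode[of "ext_gauge L" "\<lambda>_. 0"
      "\<lambda>_. (\<i> * of_real pi / (2 * of_real L)) *\<^sub>m sigma_x"] ext_gauge_hvd
  by (simp add: smooth_const mm.zero_left)

text \<open>The transformation is 1 at 0, which keeps \<open>B\<close>, and \<open>\<i>\<close>
  times \<open>sigma_x\<close> at \<open>L\<close>. Its inverse there exchanges the rows of
  \<open>M\<close>, and conjugation by it exchanges the diagonal entries of \<beta>(L), whence the
  sign of \<xi>L.\<close>

lemma hol_ext_gauge:
  assumes "hol p M B"
  shows "hol (gauge_act L (ext_gauge L) p) (mat2 0 (- \<i>) (- \<i>) 0 ** M) B"
    and "snd (gauge_act L (ext_gauge L) p) 0 = snd p 0"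
    and "snd (gauge_act L (ext_gauge L) p) L $ 1 $ 1 = snd p L $ 2 $ 2"
    and "snd (gauge_act L (ext_gauge L) p) L $ 2 $ 2 = snd p L $ 1 $ 1"
proof -
  obtain \<alpha> \<beta> where p: "p = (\<alpha>, \<beta>)" by fastforce
  then have D: "(\<alpha>, \<beta>) \<in> D_all L" and perp: "\<And>t. t \<in> {0, L} \<Longrightarrow> \<alpha> t \<in> t_perp"
    using assms by (auto simp: hol_def D_all_iff)
  obtain U where U: "transport \<alpha> U" "U L = M" using assms by (auto simp: hol_def p)
  have eq: "gauge_act L (ext_gauge L) p = (\<lambda>t\<in>J. adj2 (ext_gauge L t) ** \<alpha> t ** ext_gauge L t
      + adj2 (ext_gauge L t) ** ddt L (ext_gauge L) t,
      \<lambda>t\<in>J. adj2 (ext_gauge L t) ** \<beta> t ** ext_gauge L t)"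
    unfolding p by (rule gauge_act_eq) (rule ext_gauge_SL2)
  have adjL: "adj2 (mat2 0 \<i> \<i> 0) = mat2 0 (- \<i>) (- \<i>) 0" by (simp add: adj2_def)
  have "adj2 (ext_gauge L t) ** \<alpha> t ** ext_gauge L t
      + adj2 (ext_gauge L t) ** ddt L (ext_gauge L) t \<in> t_perp" if t: "t \<in> {0, L}" for t
  proof -
    have t': "t \<in> J" using t by auto
    \<comment> \<open>The logarithmic derivative is a constant multiple of \<open>sigma_x\<close>,
      hence off-diagonal, although the value at \<open>L\<close> is not in the torus.\<close>
    have "adj2 (ext_gauge L t) ** ddt L (ext_gauge L) t = (\<i> * of_real pi / (2 * of_real L)) *\<^sub>m sigma_x"
      using ext_gauge_SL2[OF t'] ddt_eq[OF t' ext_gauge_hvd[OF t']] by (simp add: matrix_mul_assoc)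
    moreover have "adj2 (ext_gauge L t) ** \<alpha> t ** ext_gauge L t \<in> t_perp"
      using t perp[OF t] by (auto simp: ext_gauge_ends t_perp_iff adjL cmat_mult_nth)
    ultimately show ?thesis by (simp add: t_perp_iff sigma_x_def)
  qed
  then have "gauge_act L (ext_gauge L) p \<in> D_all L"
    unfolding p by (intro gauge_act_D_all D ext_gauge_SL2 ext_gauge_smooth)
  moreover have "transport (fst (gauge_act L (ext_gauge L) p)) (\<lambda>t. adj2 (ext_gauge L t) ** U t ** ext_gauge L 0)"
    unfolding p by (rule gauge_act_transport[OF D ext_gauge_SL2 ext_gauge_smooth U(1)])
  ultimately show "hol (gauge_act L (ext_gauge L) p) (mat2 0 (- \<i>) (- \<i>) 0 ** M) B"
    and "snd (gauge_act L (ext_gauge L) p) 0 = snd p 0"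
    using assms unfolding hol_def eq
    by (auto simp: ext_gauge_ends adjL U(2) p)
  show "snd (gauge_act L (ext_gauge L) p) L $ 1 $ 1 = snd p L $ 2 $ 2"
    "snd (gauge_act L (ext_gauge L) p) L $ 2 $ 2 = snd p L $ 1 $ 1"
    unfolding eq by (simp_all add: ext_gauge_ends adjL cmat_mult_nth p mult.commute[of _ \<i>])
qed

lemma hol_unique:
  assumes "hol p M B" "hol p M' B'" shows "M = M'" "B = B'"
proof -
  obtain \<alpha> \<beta> where p: "p = (\<alpha>, \<beta>)" by fastforce
  have "\<And>t. t \<in> J \<Longrightarrow> \<alpha> t \<in> sl2" using assms by (auto simp: hol_def D_all_iff p)
  then show "M = M'" using assms transport_unique[OF _ _ _ ends_in_J(2), of \<alpha>] by (auto simp: hol_def p)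
  show "B = B'" using assms by (simp add: hol_def)
qed

end

section \<open>Classification of the normal forms\<close>

lemma diag_part_eq_iff:
  "diag_part A = (- \<i> * \<xi>) *\<^sub>m sigma_z \<longleftrightarrow> A$1$1 = - \<i> * \<xi> \<and> A$2$2 = \<i> * \<xi>"
  by (auto simp: diag_part_def sigma_z_def mat2_arith)

context interval
begin

abbreviation ext_act :: "field_pair \<Rightarrow> field_pair" where
  "ext_act \<equiv> gauge_act L (ext_gauge L)"

text \<open>Explains the range of the parameter in item (i): the invariant of \<open>M\<close>
  determines the hyperbolic cosine of twice \<open>a * L\<close>, and multiplication by
  \<open>2 * L\<close> carries that range onto the fundamental domain.\<close>

lemma cosh_domain_scale:
  "(\<exists>a' c. a = of_real a' + \<i> * of_real c \<and> c \<in> {0..pi / (2 * L)} \<and>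
      (c \<in> {0, pi / (2 * L)} \<longrightarrow> a' > 0)) \<longleftrightarrow> cosh_domain (2 * a * of_real L)"
proof -
  have "(\<exists>a' c. a = of_real a' + \<i> * of_real c \<and> c \<in> {0..pi / (2 * L)} \<and>
      (c \<in> {0, pi / (2 * L)} \<longrightarrow> a' > 0)) \<longleftrightarrow>
      Im a \<in> {0..pi / (2 * L)} \<and> (Im a \<in> {0, pi / (2 * L)} \<longrightarrow> Re a > 0)"
    by (auto simp: complex_eq_iff)
  also have "\<dots> \<longleftrightarrow> cosh_domain (2 * a * of_real L)"
    using L_pos by (auto simp: cosh_domain_def field_simps zero_less_mult_iff zero_le_mult_iff)
  finally show ?thesis .
qed

lemma form_eq:
  "form I L \<xi>0 \<xi>L = {pair_i L a \<beta>x \<xi>0 \<xi>L | a \<beta>x. cosh_domain (2 * a * of_real L)}"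
  "form II L \<xi>0 \<xi>L = range (pair_ii L \<xi>0 \<xi>L)"
  "form III L \<xi>0 \<xi>L = range (pair_iii L \<xi>0 \<xi>L)"
  "form IV L \<xi>0 \<xi>L = ext_act ` range (pair_ii L \<xi>0 (- \<xi>L))"
  "form V L \<xi>0 \<xi>L = ext_act ` range (pair_iii L \<xi>0 (- \<xi>L))"
proof -
  show "form I L \<xi>0 \<xi>L = {pair_i L a \<beta>x \<xi>0 \<xi>L | a \<beta>x. cosh_domain (2 * a * of_real L)}"
    unfolding cosh_domain_scale[symmetric] form.simps form_i_def pair_i_def by blast
qed (auto simp: form_ii_def form_iii_def form_iv_def form_v_def pair_ii_def pair_iii_def)

text \<open>Representatives of the off-diagonal entries of \<open>B\<close> under scaling by inverse
  factors. The product \<open>b * c\<close> is invariant, and for zero product the vanishing of each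
  entry decides the class.\<close>

definition reduced_vi :: "complex \<Rightarrow> complex \<Rightarrow> bool" where
  "reduced_vi b c \<longleftrightarrow> (c = 0 \<and> (b = 0 \<or> b = 1 / of_real L)) \<or> c = 1 / of_real L"

lemma pairs_vi_eq: "pairs_vi L \<xi>0 = {pair_vi L \<xi>0 b c | b c. reduced_vi b c}"
  unfolding pairs_vi_def pair_vi_1_def pair_vi_2_def pair_vi_3_def pair_vi_def reduced_vi_def
  by blast

lemma first_pairs_eq:
  "first_pairs L = range (\<lambda>\<xi>0. pair_vi L \<xi>0 0 0) \<union> range (\<lambda>\<xi>0. ext_act (pair_vi L \<xi>0 0 0))"
  by (simp add: first_pairs_def pair_vi_1_def pair_vi_def)

lemma ext_diag:
  assumes "hol p M B" "diag_part (snd p 0) = (- \<i> * \<xi>0) *\<^sub>m sigma_z"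
    "diag_part (snd p L) = (- \<i> * \<xi>L) *\<^sub>m sigma_z"
  shows "diag_part (snd (ext_act p) 0) = (- \<i> * \<xi>0) *\<^sub>m sigma_z"
    "diag_part (snd (ext_act p) L) = (- \<i> * - \<xi>L) *\<^sub>m sigma_z"
  using assms(2,3) hol_ext_gauge[OF assms(1)] unfolding diag_part_eq_iff by simp_all

lemma pair_diag:
  "sinh (2 * a * of_real L) \<noteq> 0 \<Longrightarrow> diag_part (snd (pair_i L a \<beta>x \<xi>0 \<xi>L) 0) = (- \<i> * \<xi>0) *\<^sub>m sigma_z"
  "sinh (2 * a * of_real L) \<noteq> 0 \<Longrightarrow> diag_part (snd (pair_i L a \<beta>x \<xi>0 \<xi>L) L) = (- \<i> * \<xi>L) *\<^sub>m sigma_z"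
  "diag_part (snd (pair_ii L \<xi>0 \<xi>L c) 0) = (- \<i> * \<xi>0) *\<^sub>m sigma_z"
  "diag_part (snd (pair_ii L \<xi>0 \<xi>L c) L) = (- \<i> * \<xi>L) *\<^sub>m sigma_z"
  "diag_part (snd (pair_iii L \<xi>0 \<xi>L c) 0) = (- \<i> * \<xi>0) *\<^sub>m sigma_z"
  "diag_part (snd (pair_iii L \<xi>0 \<xi>L c) L) = (- \<i> * \<xi>L) *\<^sub>m sigma_z"
  "t \<in> J \<Longrightarrow> diag_part (snd (pair_vi L \<xi>0 b c) t) = (- \<i> * \<xi>0) *\<^sub>m sigma_z"
  unfolding diag_part_eq_iff
  by (simp_all add: pair_i_def pair_ii_def pair_iii_def pair_vi_def
      sigma_x_def sigma_y_def sigma_z_def)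

text \<open>By \<open>pair_diag\<close> and \<open>ext_diag\<close> the parameters of a displayed
  pair are the diagonal coefficients of its \<beta>, so each item consists of all its displayed
  pairs. The sign of \<xi>L in (iv) and (v) is absorbed by \<open>flip\<close>, a change of
  variable.\<close>

lemma normal_forms_eq:
  "normal_forms L I = {pair_i L a \<beta>x \<xi>0 \<xi>L | a \<beta>x \<xi>0 \<xi>L. cosh_domain (2 * a * of_real L)}"
  "normal_forms L II = {pair_ii L \<xi>0 \<xi>L c | \<xi>0 \<xi>L c. True}"
  "normal_forms L III = {pair_iii L \<xi>0 \<xi>L c | \<xi>0 \<xi>L c. True}"
  "normal_forms L IV = {ext_act (pair_ii L \<xi>0 \<xi>L c) | \<xi>0 \<xi>L c. True}"
  "normal_forms L V = {ext_act (pair_iii L \<xi>0 \<xi>L c) | \<xi>0 \<xi>L c. True}"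
  "normal_forms L VI = {pair_vi L \<xi>0 b c | \<xi>0 b c. reduced_vi b c}"
  "normal_forms L VII = {ext_act (pair_vi L \<xi>0 b c) | \<xi>0 b c. reduced_vi b c}"
proof -
  have *: "normal_forms L k = P"
    if "\<And>p. p \<in> P \<longleftrightarrow> (\<exists>\<xi>0 \<xi>L. p \<in> form k L \<xi>0 \<xi>L)"
      "\<And>p \<xi>0 \<xi>L. p \<in> form k L \<xi>0 \<xi>L \<Longrightarrow> diag_part (snd p 0) = (- \<i> * \<xi>0) *\<^sub>m sigma_z \<and>
        diag_part (snd p L) = (- \<i> * \<xi>L) *\<^sub>m sigma_z" for k P
  proof -
    have "p \<in> normal_forms L k \<longleftrightarrow> (\<exists>\<xi>0 \<xi>L. diag_part (snd p 0) = (- \<i> * \<xi>0) *\<^sub>m sigma_z \<and>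
        diag_part (snd p L) = (- \<i> * \<xi>L) *\<^sub>m sigma_z \<and> p \<in> form k L \<xi>0 \<xi>L)" for p
      by (cases p) (simp add: normal_forms_def)
    then show ?thesis using that by blast
  qed
  have flip: "(\<exists>z::complex. R (- z)) \<longleftrightarrow> (\<exists>z. R z)" for R by (metis minus_minus)
  show "normal_forms L I = {pair_i L a \<beta>x \<xi>0 \<xi>L | a \<beta>x \<xi>0 \<xi>L. cosh_domain (2 * a * of_real L)}"
    by (rule *) (auto simp: form_eq pair_diag cosh_domain_sinh simp del: form.simps)
  show "normal_forms L II = {pair_ii L \<xi>0 \<xi>L c | \<xi>0 \<xi>L c. True}"
    by (rule *) (auto simp: form_eq pair_diag simp del: form.simps)
  show "normal_forms L III = {pair_iii L \<xi>0 \<xi>L c | \<xi>0 \<xi>L c. True}"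
    by (rule *) (auto simp: form_eq pair_diag simp del: form.simps)
  show "normal_forms L IV = {ext_act (pair_ii L \<xi>0 \<xi>L c) | \<xi>0 \<xi>L c. True}"
  proof (rule *)
    show "p \<in> {ext_act (pair_ii L \<xi>0 \<xi>L c) | \<xi>0 \<xi>L c. True} \<longleftrightarrow> (\<exists>\<xi>0 \<xi>L. p \<in> form IV L \<xi>0 \<xi>L)" for p
      unfolding form_eq flip[of "\<lambda>z. p \<in> ext_act ` range (pair_ii L _ z)"] by blast
  qed (use ext_diag[OF hol_ii pair_diag(3,4)] in \<open>auto simp: form_eq simp del: form.simps\<close>)
  show "normal_forms L V = {ext_act (pair_iii L \<xi>0 \<xi>L c) | \<xi>0 \<xi>L c. True}"
  proof (rule *)
    show "p \<in> {ext_act (pair_iii L \<xi>0 \<xi>L c) | \<xi>0 \<xi>L c. True} \<longleftrightarrow> (\<exists>\<xi>0 \<xi>L. p \<in> form V L \<xi>0 \<xi>L)" for p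
      unfolding form_eq flip[of "\<lambda>z. p \<in> ext_act ` range (pair_iii L _ z)"] by blast
  qed (use ext_diag[OF hol_iii pair_diag(5,6)] in \<open>auto simp: form_eq simp del: form.simps\<close>)
  show "normal_forms L VI = {pair_vi L \<xi>0 b c | \<xi>0 b c. reduced_vi b c}"
    by (rule *) (auto simp: form_vi_def pairs_vi_eq pair_diag split: if_splits)
  show "normal_forms L VII = {ext_act (pair_vi L \<xi>0 b c) | \<xi>0 b c. reduced_vi b c}"
  proof (rule *)
    show "p \<in> {ext_act (pair_vi L \<xi>0 b c) | \<xi>0 b c. reduced_vi b c} \<longleftrightarrow> (\<exists>\<xi>0 \<xi>L. p \<in> form VII L \<xi>0 \<xi>L)" for p
    proof -
      have "(\<exists>\<xi>0 \<xi>L. p \<in> form VII L \<xi>0 \<xi>L) \<longleftrightarrow> (\<exists>\<xi>0. p \<in> ext_act ` pairs_vi L \<xi>0)"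
        by (auto simp: form_vii_def split: if_splits) (metis minus_minus imageI)
      then show ?thesis unfolding pairs_vi_eq by blast
    qed
  qed (use ext_diag[OF hol_vi pair_diag(7)[OF ends_in_J(1)] pair_diag(7)[OF ends_in_J(2)]]
      in \<open>auto simp: form_vii_def pairs_vi_eq split: if_splits\<close>)
qed

lemmas hol_iv = hol_ext_gauge(1)[OF hol_ii, unfolded mat2_mult, simplified]
  and hol_v = hol_ext_gauge(1)[OF hol_iii, unfolded mat2_mult, simplified]
  and hol_vii = hol_ext_gauge(1)[OF hol_vi, unfolded mat2_mult, simplified]

text \<open>The item of a normal form is read off from the vanishing entries of its holonomy.\<close>

fun zero_pattern :: "item \<Rightarrow> bool \<times> bool \<times> bool \<times> bool" where
  "zero_pattern I = (False, False, False, False)"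
| "zero_pattern II = (False, False, True, False)"
| "zero_pattern III = (False, True, False, False)"
| "zero_pattern IV = (True, False, False, False)"
| "zero_pattern V = (False, False, False, True)"
| "zero_pattern VI = (False, True, True, False)"
| "zero_pattern VII = (True, False, False, True)"

lemma normal_form_hol:
  assumes "p \<in> normal_forms L k"
  obtains M B where "hol p M B"
    "zero_pattern k = (M$1$1 = 0, M$1$2 = 0, M$2$1 = 0, M$2$2 = 0)"
proof (cases k)
  case I
  then obtain a \<beta>x \<xi>0 \<xi>L where p: "p = pair_i L a \<beta>x \<xi>0 \<xi>L" "cosh_domain (2 * a * of_real L)"
    using assms by (auto simp: normal_forms_eq)
  have s: "sinh (2 * a * of_real L) \<noteq> 0" using cosh_domain_sinh[OF p(2)] .
  \<comment> \<open>Up to the factor 2, the nonzero \<open>sinh (2 * a * of_real L)\<close> is the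
    product of these two numbers.\<close>
  then have "sinh (a * of_real L) \<noteq> 0" "cosh (a * of_real L) \<noteq> 0"
    using sinh_double[of "a * of_real L"] by (auto simp: mult.assoc)
  then show ?thesis using that[OF hol_i[OF s, of \<beta>x \<xi>0 \<xi>L, folded p(1)]] by (simp add: I)
next
  case II
  with assms obtain \<xi>0 \<xi>L c where p: "p = pair_ii L \<xi>0 \<xi>L c" by (auto simp: normal_forms_eq)
  show ?thesis by (rule that[OF hol_ii[of \<xi>0 \<xi>L c, folded p]]) (simp add: II)
next
  case III
  with assms obtain \<xi>0 \<xi>L c where p: "p = pair_iii L \<xi>0 \<xi>L c" by (auto simp: normal_forms_eq)
  show ?thesis by (rule that[OF hol_iii[of \<xi>0 \<xi>L c, folded p]]) (simp add: III)
next
  case IV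
  with assms obtain \<xi>0 \<xi>L c where p: "p = ext_act (pair_ii L \<xi>0 \<xi>L c)" by (auto simp: normal_forms_eq)
  show ?thesis by (rule that[OF hol_iv[of \<xi>0 \<xi>L c, folded p]]) (simp add: IV)
next
  case V
  with assms obtain \<xi>0 \<xi>L c where p: "p = ext_act (pair_iii L \<xi>0 \<xi>L c)" by (auto simp: normal_forms_eq)
  show ?thesis by (rule that[OF hol_v[of \<xi>0 \<xi>L c, folded p]]) (simp add: V)
next
  case VI
  with assms obtain \<xi>0 b c where p: "p = pair_vi L \<xi>0 b c" by (auto simp: normal_forms_eq)
  show ?thesis by (rule that[OF hol_vi[of \<xi>0 b c, folded p]]) (simp add: VI)
next
  case VII
  with assms obtain \<xi>0 b c where p: "p = ext_act (pair_vi L \<xi>0 b c)" by (auto simp: normal_forms_eq)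
  show ?thesis by (rule that[OF hol_vii[of \<xi>0 b c, folded p]]) (simp add: VII)
qed

section \<open>Uniqueness of representatives, and stabilizers\<close>

lemma zero_pattern_inj: "zero_pattern k = zero_pattern k' \<Longrightarrow> k = k'"
  by (cases k; cases k') simp_all

text \<open>In (i) to (v) some diagonal and some off-diagonal entry of \<open>M\<close> is nonzero.
  Once the matrices agree, the former gives \<open>x = y\<close> and the latter
  \<open>x * y = 1\<close>.\<close>

lemma normal_form_square_one:
  assumes k: "k \<noteq> VI" "k \<noteq> VII" and p: "p \<in> normal_forms L k" and q: "q \<in> normal_forms L k"
    and hol: "hol p M B" "hol q M' B'" and rel: "torus_related x y M B M' B'"
  shows "x\<^sup>2 = 1" "M = M'"
proof -
  have "x\<^sup>2 = 1 \<and> M = M'"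
  proof (cases k)
    case I
    obtain a \<beta>x \<xi>0 \<xi>L where p': "p = pair_i L a \<beta>x \<xi>0 \<xi>L" "cosh_domain (2 * a * of_real L)"
      using p by (auto simp: normal_forms_eq I)
    obtain a' \<beta>x' \<xi>0' \<xi>L' where q': "q = pair_i L a' \<beta>x' \<xi>0' \<xi>L'" "cosh_domain (2 * a' * of_real L)"
      using q by (auto simp: normal_forms_eq I)
    have s: "sinh (2 * a * of_real L) \<noteq> 0" "sinh (2 * a' * of_real L) \<noteq> 0"
      using cosh_domain_sinh p'(2) q'(2) by auto
    note M = hol_unique(1)[OF hol(1)[unfolded p'(1)] hol_i[OF s(1)]]
      and M' = hol_unique(1)[OF hol(2)[unfolded q'(1)] hol_i[OF s(2)]]
    let ?ch = "cosh (a * of_real L)" and ?ch' = "cosh (a' * of_real L)"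
      and ?sh = "sinh (a * of_real L)" and ?sh' = "sinh (a' * of_real L)"
    have r: "x \<noteq> 0" "y \<noteq> 0" "?ch * x = y * ?ch'" "- ?sh = x * y * - ?sh'" "?ch * y = x * ?ch'"
      using rel[unfolded M M'] by (auto simp: torus_related_def cmat_eq_iff cmat_mult_nth field_simps)
    \<comment> \<open>Multiplying the equations for the two diagonal entries cancels
      \<open>x\<close> and \<open>y\<close>. Only the square of \<open>?ch\<close> is determined, so
      the comparison passes to the doubled argument, where \<open>cosh_domain_inj\<close>
      applies.\<close>
    have "?ch\<^sup>2 * (x * y) = ?ch'\<^sup>2 * (x * y)"
      using arg_cong2[OF r(3) r(5), of "(*)"] by (simp add: power2_eq_square algebra_simps)
    then have "?ch\<^sup>2 = ?ch'\<^sup>2" using r by simp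
    then have "cosh (2 * (a * of_real L)) = cosh (2 * (a' * of_real L))"
      by (simp add: cosh_double_cosh)
    then have "a = a'" using cosh_domain_inj[OF p'(2) q'(2)] by (simp add: mult.assoc)
    moreover have "?sh \<noteq> 0" "?ch \<noteq> 0"
      using s(1) sinh_double[of "a * of_real L"] by (auto simp: mult.assoc)
    ultimately have "x = y" "x * y = 1" "M = M'" using r M M' by auto
    then show ?thesis by (simp add: power2_eq_square)
  next
    case II
    with p q obtain \<xi>0 \<xi>L c \<xi>0' \<xi>L' c' where e: "p = pair_ii L \<xi>0 \<xi>L c" "q = pair_ii L \<xi>0' \<xi>L' c'"
      by (auto simp: normal_forms_eq)
    show ?thesis
      using rel hol_unique(1)[OF hol(1)[unfolded e] hol_ii] hol_unique(1)[OF hol(2)[unfolded e] hol_ii]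
      by (auto simp: torus_related_def cmat_eq_iff cmat_mult_nth field_simps power2_eq_square)
  next
    case III
    with p q obtain \<xi>0 \<xi>L c \<xi>0' \<xi>L' c' where e: "p = pair_iii L \<xi>0 \<xi>L c" "q = pair_iii L \<xi>0' \<xi>L' c'"
      by (auto simp: normal_forms_eq)
    show ?thesis
      using rel hol_unique(1)[OF hol(1)[unfolded e] hol_iii] hol_unique(1)[OF hol(2)[unfolded e] hol_iii]
      by (auto simp: torus_related_def cmat_eq_iff cmat_mult_nth field_simps power2_eq_square)
  next
    case IV
    with p q obtain \<xi>0 \<xi>L c \<xi>0' \<xi>L' c' where e: "p = ext_act (pair_ii L \<xi>0 \<xi>L c)" "q = ext_act (pair_ii L \<xi>0' \<xi>L' c')"
      by (auto simp: normal_forms_eq)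
    show ?thesis
      using rel hol_unique(1)[OF hol(1)[unfolded e] hol_iv] hol_unique(1)[OF hol(2)[unfolded e] hol_iv]
      by (auto simp: torus_related_def cmat_eq_iff cmat_mult_nth field_simps power2_eq_square)
  next
    case V
    with p q obtain \<xi>0 \<xi>L c \<xi>0' \<xi>L' c' where e: "p = ext_act (pair_iii L \<xi>0 \<xi>L c)" "q = ext_act (pair_iii L \<xi>0' \<xi>L' c')"
      by (auto simp: normal_forms_eq)
    show ?thesis
      using rel hol_unique(1)[OF hol(1)[unfolded e] hol_v] hol_unique(1)[OF hol(2)[unfolded e] hol_v]
      by (auto simp: torus_related_def cmat_eq_iff cmat_mult_nth field_simps power2_eq_square)
  qed (use k in simp_all)
  then show "x\<^sup>2 = 1" "M = M'" by simp_all
qed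

lemma reduced_vi_unique:
  assumes "reduced_vi b c" "reduced_vi b' c'" "b = x\<^sup>2 * b'" "c * x\<^sup>2 = c'" "x \<noteq> 0"
  shows "b = b'" "c = c'"
proof -
  have "b = b' \<and> c = c'"
  proof (cases "c = 0")
    case True
    then show ?thesis using assms by (auto simp: reduced_vi_def)
  next
    case False
    then have "c = 1 / of_real L" "c' = 1 / of_real L" using assms by (auto simp: reduced_vi_def)
    moreover from this have "x\<^sup>2 = 1" using assms(4) by simp
    ultimately show ?thesis using assms(3) by simp
  qed
  then show "b = b'" "c = c'" by simp_all
qed

text \<open>In (i) to (v) the relation forces \<open>B = B'\<close>, and the parameters of \<beta>
  are recovered from that matrix. In (vi) and (vii) scaling of the off-diagonal entries is still
  possible, and \<open>reduced_vi_unique\<close> settles it.\<close>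

lemma normal_form_unique:
  assumes p: "p \<in> normal_forms L k" and q: "q \<in> normal_forms L k"
    and hol: "hol p M B" "hol q M' B'" and rel: "torus_related x y M B M' B'"
  shows "p = q"
proof (cases k)
  case I
  obtain a \<beta>x \<xi>0 \<xi>L where p': "p = pair_i L a \<beta>x \<xi>0 \<xi>L" "cosh_domain (2 * a * of_real L)"
    using p by (auto simp: normal_forms_eq I)
  obtain a' \<beta>x' \<xi>0' \<xi>L' where q': "q = pair_i L a' \<beta>x' \<xi>0' \<xi>L'" "cosh_domain (2 * a' * of_real L)"
    using q by (auto simp: normal_forms_eq I)
  have s: "sinh (2 * a * of_real L) \<noteq> 0" "sinh (2 * a' * of_real L) \<noteq> 0"
    using cosh_domain_sinh p'(2) q'(2) by auto
  note h = hol_unique[OF hol(1)[unfolded p'(1)] hol_i[OF s(1)]]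
    hol_unique[OF hol(2)[unfolded q'(1)] hol_i[OF s(2)]]
  have x: "x\<^sup>2 = 1" and "M = M'" using normal_form_square_one[OF _ _ p q hol rel] I by simp_all
  then have "cosh (a * of_real L) = cosh (a' * of_real L)" by (simp add: h)
  then have "cosh (2 * (a * of_real L)) = cosh (2 * (a' * of_real L))"
    by (simp add: cosh_double_cosh)
  then have a: "a = a'" using cosh_domain_inj[OF p'(2) q'(2)] by (simp add: mult.assoc)
  have "B = B'" by (rule torus_related_square_one[OF rel x])
  note eq = this[unfolded h mat2_eq_iff]
  have e: "\<xi>0 = \<xi>0'" "\<beta>x - \<i> * y_i L a \<xi>0 \<xi>L = \<beta>x' - \<i> * y_i L a' \<xi>0' \<xi>L'"
    "\<beta>x + \<i> * y_i L a \<xi>0 \<xi>L = \<beta>x' + \<i> * y_i L a' \<xi>0' \<xi>L'"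
    using eq by (simp, blast+)
  \<comment> \<open>The sum of the off-diagonal entries of \<open>B\<close> gives \<beta>x, after
    which either of them gives \<open>y_i\<close> and hence \<xi>L.\<close>
  have "2 * \<beta>x = 2 * \<beta>x'" using arg_cong2[OF e(2) e(3), of "(+)"] by simp
  moreover from this have "y_i L a \<xi>0 \<xi>L = y_i L a' \<xi>0' \<xi>L'" using e(2) by simp
  then have "\<xi>L = \<xi>L'" using s by (simp add: y_i_def a e(1) divide_simps)
  ultimately show ?thesis by (simp add: p' q' a e(1))
next
  case II
  with p q obtain \<xi>0 \<xi>L c \<xi>0' \<xi>L' c' where e: "p = pair_ii L \<xi>0 \<xi>L c" "q = pair_ii L \<xi>0' \<xi>L' c'"
    by (auto simp: normal_forms_eq)
  have "B = B'"
    using torus_related_square_one[OF rel normal_form_square_one(1)[OF _ _ p q hol rel]] II by simp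
  then show ?thesis
    using hol_unique(2)[OF hol(1)[unfolded e] hol_ii] hol_unique(2)[OF hol(2)[unfolded e] hol_ii]
    by (auto simp: e)
next
  case III
  with p q obtain \<xi>0 \<xi>L c \<xi>0' \<xi>L' c' where e: "p = pair_iii L \<xi>0 \<xi>L c" "q = pair_iii L \<xi>0' \<xi>L' c'"
    by (auto simp: normal_forms_eq)
  have "B = B'"
    using torus_related_square_one[OF rel normal_form_square_one(1)[OF _ _ p q hol rel]] III by simp
  then show ?thesis
    using hol_unique(2)[OF hol(1)[unfolded e] hol_iii] hol_unique(2)[OF hol(2)[unfolded e] hol_iii]
    by (auto simp: e)
next
  case IV
  with p q obtain \<xi>0 \<xi>L c \<xi>0' \<xi>L' c' where e: "p = ext_act (pair_ii L \<xi>0 \<xi>L c)" "q = ext_act (pair_ii L \<xi>0' \<xi>L' c')"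
    by (auto simp: normal_forms_eq)
  have "B = B'"
    using torus_related_square_one[OF rel normal_form_square_one(1)[OF _ _ p q hol rel]] IV by simp
  then show ?thesis
    using hol_unique(2)[OF hol(1)[unfolded e] hol_iv] hol_unique(2)[OF hol(2)[unfolded e] hol_iv]
    by (auto simp: e)
next
  case V
  with p q obtain \<xi>0 \<xi>L c \<xi>0' \<xi>L' c' where e: "p = ext_act (pair_iii L \<xi>0 \<xi>L c)" "q = ext_act (pair_iii L \<xi>0' \<xi>L' c')"
    by (auto simp: normal_forms_eq)
  have "B = B'"
    using torus_related_square_one[OF rel normal_form_square_one(1)[OF _ _ p q hol rel]] V by simp
  then show ?thesis
    using hol_unique(2)[OF hol(1)[unfolded e] hol_v] hol_unique(2)[OF hol(2)[unfolded e] hol_v]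
    by (auto simp: e)
next
  case VI
  with p q obtain \<xi>0 b c \<xi>0' b' c' where e: "p = pair_vi L \<xi>0 b c" "q = pair_vi L \<xi>0' b' c'"
    "reduced_vi b c" "reduced_vi b' c'"
    by (auto simp: normal_forms_eq)
  note u = hol_unique[OF hol(1)[unfolded e] hol_vi] hol_unique[OF hol(2)[unfolded e] hol_vi]
  have "torus_related x y (mat2 1 0 0 1) (mat2 (- \<i> * \<xi>0) b c (\<i> * \<xi>0))
      (mat2 1 0 0 1) (mat2 (- \<i> * \<xi>0') b' c' (\<i> * \<xi>0'))"
    using rel by (simp only: u)
  then have r: "x \<noteq> 0" "b = x\<^sup>2 * b'" "c * x\<^sup>2 = c'" and "\<i> * \<xi>0 = \<i> * \<xi>0'"
    unfolding torus_related_mat2 by blast+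
  then have "\<xi>0 = \<xi>0'" by simp
  show ?thesis using reduced_vi_unique[OF e(3,4) r(2,3,1)] \<open>\<xi>0 = \<xi>0'\<close> by (simp add: e(1,2))
next
  case VII
  with p q obtain \<xi>0 b c \<xi>0' b' c' where e: "p = ext_act (pair_vi L \<xi>0 b c)" "q = ext_act (pair_vi L \<xi>0' b' c')"
    "reduced_vi b c" "reduced_vi b' c'"
    by (auto simp: normal_forms_eq)
  note u = hol_unique[OF hol(1)[unfolded e] hol_vii] hol_unique[OF hol(2)[unfolded e] hol_vii]
  have "torus_related x y (mat2 0 (- \<i>) (- \<i>) 0) (mat2 (- (\<i> * \<xi>0)) b c (\<i> * \<xi>0))
      (mat2 0 (- \<i>) (- \<i>) 0) (mat2 (- (\<i> * \<xi>0')) b' c' (\<i> * \<xi>0'))"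
    using rel by (simp only: u)
  then have r: "x \<noteq> 0" "b = x\<^sup>2 * b'" "c * x\<^sup>2 = c'" and "\<i> * \<xi>0 = \<i> * \<xi>0'"
    unfolding torus_related_mat2 by blast+
  then have "\<xi>0 = \<xi>0'" by simp
  show ?thesis using reduced_vi_unique[OF e(3,4) r(2,3,1)] \<open>\<xi>0 = \<xi>0'\<close> by (simp add: e(1,2))
qed

text \<open>In (vi) and (vii) the matrix \<open>M\<close> leaves \<open>x\<close> free, but outside
  the first pairs an off-diagonal entry of \<open>B\<close> is nonzero and must be fixed under
  scaling by the square of \<open>x\<close>.\<close>

lemma normal_form_stabilizer:
  assumes p: "p \<in> normal_forms L k" "p \<notin> first_pairs L" and hol: "hol p M B"
    and rel: "torus_related x y M B M B"
  shows "x\<^sup>2 = 1"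
proof (cases "k = VI \<or> k = VII")
  case True
  then obtain \<xi>0 b c where r: "reduced_vi b c" and e: "p = pair_vi L \<xi>0 b c \<or> p = ext_act (pair_vi L \<xi>0 b c)"
    using p(1) by (elim disjE; simp add: normal_forms_eq; blast)
  have "b \<noteq> 0 \<or> c \<noteq> 0" using p(2) e by (auto simp: first_pairs_eq)
  moreover have "hol p (mat2 1 0 0 1) (mat2 (- \<i> * \<xi>0) b c (\<i> * \<xi>0)) \<or>
      hol p (mat2 0 (- \<i>) (- \<i>) 0) (mat2 (- \<i> * \<xi>0) b c (\<i> * \<xi>0))"
    using e hol_vi[of \<xi>0 b c] hol_vii[of \<xi>0 b c] by auto
  then have "B = mat2 (- \<i> * \<xi>0) b c (\<i> * \<xi>0)"
    using hol_unique(2)[OF hol] by blast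
  ultimately show ?thesis
    using rel by (auto simp: torus_related_def cmat_eq_iff cmat_mult_nth field_simps power2_eq_square)
next
  case False
  then show ?thesis using normal_form_square_one(1)[OF _ _ p(1) p(1) hol hol rel] by simp
qed

text \<open>\<open>B\<close> is diagonal, so every \<open>x\<close> is allowed: with
  \<open>y = x\<close> when \<open>M\<close> is the identity, and with \<open>y\<close> inverse to
  \<open>x\<close> when \<open>M\<close> is antidiagonal.\<close>

lemma first_pair_torus:
  assumes "p \<in> first_pairs L"
  obtains M B where "hol p M B" "\<And>x. x \<noteq> 0 \<Longrightarrow> \<exists>y. torus_related x y M B M B"
proof -
  from assms obtain \<xi>0 where "p = pair_vi L \<xi>0 0 0 \<or> p = ext_act (pair_vi L \<xi>0 0 0)"
    by (auto simp: first_pairs_eq)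
  then show ?thesis
  proof
    assume p: "p = pair_vi L \<xi>0 0 0"
    show ?thesis
    proof (rule that[OF hol_vi[of \<xi>0 0 0, folded p]])
      fix x :: complex assume "x \<noteq> 0"
      then show "\<exists>y. torus_related x y (mat2 1 0 0 1) (mat2 (- \<i> * \<xi>0) 0 0 (\<i> * \<xi>0))
          (mat2 1 0 0 1) (mat2 (- \<i> * \<xi>0) 0 0 (\<i> * \<xi>0))"
        by (intro exI[of _ x]) (simp add: torus_related_mat2)
    qed
  next
    assume p: "p = ext_act (pair_vi L \<xi>0 0 0)"
    show ?thesis
    proof (rule that[OF hol_vii[of \<xi>0 0 0, folded p]])
      fix x :: complex assume "x \<noteq> 0"
      then show "\<exists>y. torus_related x y (mat2 0 (- \<i>) (- \<i>) 0) (mat2 (- (\<i> * \<xi>0)) 0 0 (\<i> * \<xi>0))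
          (mat2 0 (- \<i>) (- \<i>) 0) (mat2 (- (\<i> * \<xi>0)) 0 0 (\<i> * \<xi>0))"
        by (intro exI[of _ "inverse x"]) (simp add: torus_related_mat2)
    qed
  qed
qed


section \<open>Existence of a normal form for every holonomy\<close>

lemma normal_form_exists_generic:
  assumes det: "p * s - q * r = 1" and nz: "p * s \<noteq> 0" "q * r \<noteq> 0"
  shows "\<exists>P M' B' x y. P \<in> normal_forms L I \<and> hol P M' B' \<and>
    torus_related x y (mat2 p q r s) (mat2 a b c (- a)) M' B'"
proof -
  \<comment> \<open>If w is the parameter of item (i) times \<open>L\<close>, the requirement cosh^2
    w = ps reads cosh (2 w) = 2 ps - 1. The excluded values 1 and -1 are the cases
    \<open>qr = 0\<close> and \<open>ps = 0\<close>.\<close>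
  have "2 * (p * s) - 1 \<noteq> 1" using det nz by auto
  moreover have "2 * (p * s) - 1 \<noteq> -1" using nz by auto
  ultimately obtain z where z: "cosh_domain z" "cosh z = 2 * (p * s) - 1"
    using cosh_domain_surj by blast
  define \<alpha>0 where "\<alpha>0 = z / (2 * of_real L)"
  have z': "z = 2 * \<alpha>0 * of_real L" "z = 2 * (\<alpha>0 * of_real L)" by (simp_all add: \<alpha>0_def)
  have sz: "sinh (2 * \<alpha>0 * of_real L) \<noteq> 0" using cosh_domain_sinh[OF z(1)] by (simp add: z')
  define ch sh where "ch = cosh (\<alpha>0 * of_real L)" and "sh = sinh (\<alpha>0 * of_real L)"
  have "2 * ch\<^sup>2 - 1 = 2 * (p * s) - 1"
    using z(2) unfolding z'(2) cosh_double_cosh ch_def by simp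
  then have ch: "ch * ch = p * s" by (simp add: power2_eq_square)
  have "ch\<^sup>2 = sh\<^sup>2 + 1" unfolding ch_def sh_def by (rule cosh_square_eq)
  then have sh: "sh * sh = q * r" using ch det by (simp add: power2_eq_square algebra_simps)
  have nz': "ch \<noteq> 0" "sh \<noteq> 0" "p \<noteq> 0" "q \<noteq> 0" "r \<noteq> 0" "s \<noteq> 0" using ch sh nz by auto
  \<comment> \<open>The entry \<open>q\<close> must be \<open>x * y * - sh\<close>, so
    \<open>m\<close> is the required value of \<open>x * y\<close>. With
    \<open>p * x = y * ch\<close> this prescribes the square of \<open>x\<close>.\<close>
  define m where "m = - (q / sh)"
  define x where "x = csqrt (ch / p * m)"
  define y where "y = m / x"
  have m: "m \<noteq> 0" using nz' by (simp add: m_def)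
  have x: "x * x = ch / p * m"
    using power2_csqrt[of "ch / p * m"] by (simp add: x_def power2_eq_square)
  then have x0: "x \<noteq> 0" using m nz' by auto
  have xy: "x * y = m" using x0 by (simp add: y_def)
  have y0: "y \<noteq> 0" using x0 m by (simp add: y_def)
  define b' c' where "b' = b / x\<^sup>2" and "c' = c * x\<^sup>2"
  define \<xi>0 where "\<xi>0 = \<i> * a"
  define \<beta>x where "\<beta>x = (b' + c') / 2"
  \<comment> \<open>Solves \<open>y_i = (c' - b') / (2 * \<i>)\<close>; together with \<beta>x as
    the mean of \<open>b'\<close> and \<open>c'\<close> it produces the prescribed off-diagonal
    entries.\<close>
  define \<xi>L where "\<xi>L = (c' - b') / (2 * \<i>) * sinh (2 * \<alpha>0 * of_real L) + \<xi>0 * cosh (2 * \<alpha>0 * of_real L)"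
  have yi: "y_i L \<alpha>0 \<xi>0 \<xi>L = (c' - b') / (2 * \<i>)" using sz by (simp add: y_i_def \<xi>L_def)
  have e: "\<beta>x - \<i> * y_i L \<alpha>0 \<xi>0 \<xi>L = b'" "\<beta>x + \<i> * y_i L \<alpha>0 \<xi>0 \<xi>L = c'"
    unfolding yi \<beta>x_def by (simp_all add: field_simps)
  have h: "hol (pair_i L \<alpha>0 \<beta>x \<xi>0 \<xi>L) (mat2 ch (- sh) (- sh) ch) (mat2 a b' c' (- a))"
    using hol_i[OF sz, of \<beta>x \<xi>0 \<xi>L] unfolding e by (simp add: ch_def sh_def \<xi>0_def)
  moreover have "pair_i L \<alpha>0 \<beta>x \<xi>0 \<xi>L \<in> normal_forms L I"
    using z(1) unfolding z'(1) normal_forms_eq by blast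
  moreover have "torus_related x y (mat2 p q r s) (mat2 a b c (- a)) (mat2 ch (- sh) (- sh) ch) (mat2 a b' c' (- a))"
    unfolding torus_related_mat2
  proof (intro conjI x0 y0 refl)
    have "(p * x - y * ch) * x = 0"
      using x xy nz' by (simp add: algebra_simps)
    then show "p * x = y * ch" using x0 by simp
    show "q = x * y * - sh" using nz' by (simp add: xy m_def)
    have "(r * m + sh) * sh = 0" using sh nz' by (simp add: m_def field_simps)
    then show "r * x * y = - sh" using nz' by (simp add: mult.assoc xy eq_neg_iff_add_eq_0)
    have "(s * y - x * ch) * x * p = m * (p * s - ch * ch)"
      using x xy nz' by (simp add: algebra_simps)
    then show "s * y = x * ch" using x0 nz' ch by simp
    show "b = x\<^sup>2 * b'" "c * x\<^sup>2 = c'" using x0 by (simp_all add: b'_def c'_def)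
  qed
  ultimately show ?thesis by blast
qed

text \<open>The parameters of item (ii) reach every traceless \<open>B\<close>: the diagonal fixes
  \<xi>0, the lower left entry then \<xi>L, and the upper right entry the constant. The same
  parameters serve item (iv), as the extended transformation keeps \<open>B\<close>.\<close>

lemma hol_ii_param:
  "\<exists>\<xi>0 \<xi>L k. hol (pair_ii L \<xi>0 \<xi>L k) (mat2 1 (-1) 0 1) (mat2 a b c (- a)) \<and>
     hol (ext_act (pair_ii L \<xi>0 \<xi>L k)) (mat2 0 (- \<i>) (- \<i>) \<i>) (mat2 a b c (- a))"
proof -
  define \<xi>0 where "\<xi>0 = \<i> * a"
  define \<xi>L where "\<xi>L = \<xi>0 - \<i> * c"
  define k where "k = \<i> * b * of_real L - (\<xi>L - \<xi>0) * of_real L"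
  have "- (\<i> / of_real L) * ((\<xi>L - \<xi>0) * of_real L + k) = b" "- \<i> * (\<xi>0 - \<xi>L) = c"
    "- \<i> * \<xi>0 = a" "\<i> * \<xi>0 = - a"
    by (simp_all add: k_def \<xi>L_def \<xi>0_def)
  from hol_ii[of \<xi>0 \<xi>L k, unfolded this] have "hol (pair_ii L \<xi>0 \<xi>L k) (mat2 1 (-1) 0 1) (mat2 a b c (- a))" .
  with hol_ext_gauge(1)[OF this] show ?thesis by (auto simp: mat2_mult)
qed

lemma hol_iii_param:
  "\<exists>\<xi>0 \<xi>L k. hol (pair_iii L \<xi>0 \<xi>L k) (mat2 1 0 (-1) 1) (mat2 a b c (- a)) \<and>
     hol (ext_act (pair_iii L \<xi>0 \<xi>L k)) (mat2 \<i> (- \<i>) (- \<i>) 0) (mat2 a b c (- a))"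
proof -
  define \<xi>0 where "\<xi>0 = \<i> * a"
  define \<xi>L where "\<xi>L = \<xi>0 + \<i> * b"
  define k where "k = \<i> * c * of_real L - (\<xi>0 - \<xi>L) * of_real L"
  have "- (\<i> / of_real L) * ((\<xi>0 - \<xi>L) * of_real L + k) = c" "\<i> * (\<xi>0 - \<xi>L) = b"
    "- \<i> * \<xi>0 = a" "\<i> * \<xi>0 = - a"
    by (simp_all add: k_def \<xi>L_def \<xi>0_def)
  from hol_iii[of \<xi>0 \<xi>L k, unfolded this] have "hol (pair_iii L \<xi>0 \<xi>L k) (mat2 1 0 (-1) 1) (mat2 a b c (- a))" .
  with hol_ext_gauge(1)[OF this] show ?thesis by (auto simp: mat2_mult)
qed

text \<open>A nonzero \<open>c\<close> is scaled to \<open>1 / of_real L\<close>, which turns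
  \<open>b\<close> into \<open>b * c * of_real L\<close> because the product is invariant. Only when
  \<open>c = 0\<close> is a nonzero \<open>b\<close> scaled instead.\<close>

lemma reduced_vi_exists:
  obtains x b' c' where "x \<noteq> 0" "b = x\<^sup>2 * b'" "c * x\<^sup>2 = c'" "reduced_vi b' c'"
proof -
  consider "b = 0" "c = 0" | "b \<noteq> 0" "c = 0" | "c \<noteq> 0" by blast
  then show ?thesis
  proof cases
    case 1 then show ?thesis using that[of 1 0 0] by (simp add: reduced_vi_def)
  next
    case 2 then show ?thesis
      using that[of "csqrt (b * of_real L)" "1 / of_real L" 0] by (simp add: reduced_vi_def)
  next
    case 3 then show ?thesis
      using that[of "csqrt (1 / (c * of_real L))" "b * (c * of_real L)" "1 / of_real L"]
      by (simp add: reduced_vi_def)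
  qed
qed

lemma normal_form_exists:
  assumes M: "M \<in> SL2" and B: "B \<in> sl2"
  shows "\<exists>k P M' B' x y. P \<in> normal_forms L k \<and> hol P M' B' \<and> torus_related x y M B M' B'"
proof -
  obtain p q r s where Meq: "M = mat2 p q r s" using mat2_collapse[of M] by metis
  obtain a b c where Beq: "B = mat2 a b c (- a)"
    using mat2_collapse[of B] B by (metis sl2_iff)
  have det: "p * s - q * r = 1" using M by (simp add: Meq SL2_iff)
  then have qr_eq: "q * r = p * s - 1" by (simp add: algebra_simps)
  let ?B = "\<lambda>x. mat2 a (b / x\<^sup>2) (c * x\<^sup>2) (- a)"
  have rel: "torus_related x y M B (mat2 p' q' r' s') (?B x)"
    if "x \<noteq> 0" "y \<noteq> 0" "p * x = y * p'" "q = x * y * q'" "r * x * y = r'" "s * y = x * s'"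
    for x y p' q' r' s'
    using that by (simp add: torus_related_mat2 Meq Beq)
  \<comment> \<open>By \<open>det\<close>, these are all patterns of zeros, in the order of the
    items (i), (ii), (iii), (vi), (iv), (v), (vii).\<close>
  consider "p * s \<noteq> 0" "q * r \<noteq> 0" | "r = 0" "q \<noteq> 0" | "q = 0" "r \<noteq> 0" | "q = 0" "r = 0"
    | "p = 0" "s \<noteq> 0" | "s = 0" "p \<noteq> 0" | "p = 0" "s = 0" by fastforce
  then show ?thesis
  proof cases
    case 1
    then show ?thesis using normal_form_exists_generic[OF det 1] unfolding Meq Beq by blast
  next
    case 2
    then have ps: "p * s = 1" "p \<noteq> 0" using det by auto
    \<comment> \<open>The nonzero diagonal entry forces \<open>y = p * x\<close>, and the nonzero
      off-diagonal entry then prescribes the square of \<open>x\<close>. The square roots in cases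
      3, 5 and 6 arise in the same way.\<close>
    define x where "x = csqrt (- (q / p))"
    have x: "x * x = - (q / p)" using power2_csqrt[of "- (q / p)"] by (simp add: x_def power2_eq_square)
    then have x0: "x \<noteq> 0" using 2 ps by auto
    obtain \<xi>0 \<xi>L k where h: "hol (pair_ii L \<xi>0 \<xi>L k) (mat2 1 (-1) 0 1) (?B x)"
      using hol_ii_param by blast
    have "torus_related x (p * x) M B (mat2 1 (-1) 0 1) (?B x)"
    proof (rule rel)
      have "x * (p * x) = p * (x * x)" by simp
      then show "q = x * (p * x) * -1" using x ps by simp
      have "s * (p * x) = (p * s) * x" by simp
      then show "s * (p * x) = x * 1" using ps by simp
    qed (use x0 ps 2 in simp_all)
    moreover have "pair_ii L \<xi>0 \<xi>L k \<in> normal_forms L II" unfolding normal_forms_eq by blast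
    ultimately show ?thesis using h by blast
  next
    case 3
    then have ps: "p * s = 1" "p \<noteq> 0" using det by auto
    define x where "x = csqrt (- 1 / (r * p))"
    have x: "x * x = - 1 / (r * p)" using power2_csqrt[of "- 1 / (r * p)"] by (simp add: x_def power2_eq_square)
    then have x0: "x \<noteq> 0" using 3 ps by auto
    obtain \<xi>0 \<xi>L k where h: "hol (pair_iii L \<xi>0 \<xi>L k) (mat2 1 0 (-1) 1) (?B x)"
      using hol_iii_param by blast
    have "torus_related x (p * x) M B (mat2 1 0 (-1) 1) (?B x)"
    proof (rule rel)
      have "r * x * (p * x) = r * p * (x * x)" by simp
      then show "r * x * (p * x) = -1" using x ps 3 by simp
      have "s * (p * x) = (p * s) * x" by simp
      then show "s * (p * x) = x * 1" using ps by simp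
    qed (use x0 ps 3 in simp_all)
    moreover have "pair_iii L \<xi>0 \<xi>L k \<in> normal_forms L III" unfolding normal_forms_eq by blast
    ultimately show ?thesis using h by blast
  next
    case 4
    then have ps: "p * s = 1" "p \<noteq> 0" using det by auto
    \<comment> \<open>Here \<open>M\<close> determines only \<open>y / x\<close>, and in case 7 only
      \<open>x * y\<close>. The free \<open>x\<close> is spent on reducing \<open>B\<close>.\<close>
    obtain x b' c' where x: "x \<noteq> 0" "b = x\<^sup>2 * b'" "c * x\<^sup>2 = c'" "reduced_vi b' c'"
      by (rule reduced_vi_exists)
    have h: "hol (pair_vi L (\<i> * a) b' c') (mat2 1 0 0 1) (mat2 a b' c' (- a))"
      using hol_vi[of "\<i> * a" b' c'] by simp
    have "s * (p * x) = (p * s) * x" by simp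
    then have "torus_related x (p * x) M B (mat2 1 0 0 1) (mat2 a b' c' (- a))"
      using x ps 4 by (simp add: Meq Beq torus_related_mat2)
    moreover have "pair_vi L (\<i> * a) b' c' \<in> normal_forms L VI"
      unfolding normal_forms_eq using x(4) by blast
    ultimately show ?thesis using h by blast
  next
    case 5
    then have "q * r = -1" by (auto simp: qr_eq)
    then have qr: "q * r = -1" "q \<noteq> 0" by auto
    define x where "x = csqrt (q * s)"
    have x: "x * x = q * s" using power2_csqrt[of "q * s"] by (simp add: x_def power2_eq_square)
    then have x0: "x \<noteq> 0" using 5 qr by auto
    obtain \<xi>0 \<xi>L k where h: "hol (ext_act (pair_ii L \<xi>0 \<xi>L k)) (mat2 0 (- \<i>) (- \<i>) \<i>) (?B x)"
      using hol_ii_param by blast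
    have xy: "x * (\<i> * x / s) = \<i> * q" using x 5 by (simp add: field_simps)
    have "torus_related x (\<i> * x / s) M B (mat2 0 (- \<i>) (- \<i>) \<i>) (?B x)"
    proof (rule rel)
      show "q = x * (\<i> * x / s) * - \<i>" unfolding xy by (simp add: mult.commute[of _ \<i>])
      have "r * x * (\<i> * x / s) = \<i> * (q * r)" unfolding mult.assoc xy by simp
      then show "r * x * (\<i> * x / s) = - \<i>" using qr by simp
    qed (use x0 qr 5 in simp_all)
    moreover have "ext_act (pair_ii L \<xi>0 \<xi>L k) \<in> normal_forms L IV" unfolding normal_forms_eq by blast
    ultimately show ?thesis using h by blast
  next
    case 6
    then have "q * r = -1" by (auto simp: qr_eq)
    then have qr: "q * r = -1" "q \<noteq> 0" by auto
    define x where "x = csqrt (- (q / p))"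
    have x: "x * x = - (q / p)" using power2_csqrt[of "- (q / p)"] by (simp add: x_def power2_eq_square)
    then have x0: "x \<noteq> 0" using 6 qr by auto
    obtain \<xi>0 \<xi>L k where h: "hol (ext_act (pair_iii L \<xi>0 \<xi>L k)) (mat2 \<i> (- \<i>) (- \<i>) 0) (?B x)"
      using hol_iii_param by blast
    have "x * (- \<i> * p * x) = - \<i> * p * (x * x)" by simp
    then have xy: "x * (- \<i> * p * x) = \<i> * q" using x 6 by simp
    have "torus_related x (- \<i> * p * x) M B (mat2 \<i> (- \<i>) (- \<i>) 0) (?B x)"
    proof (rule rel)
      have "- \<i> * z * \<i> = z" for z by (simp add: mult.commute[of _ \<i>])
      from this[of "p * x"] show "p * x = - \<i> * p * x * \<i>" by (simp add: mult.assoc)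
      show "q = x * (- \<i> * p * x) * - \<i>" unfolding xy by (simp add: mult.commute[of _ \<i>])
      have "r * x * (- \<i> * p * x) = \<i> * (q * r)" unfolding mult.assoc[of r] xy by simp
      then show "r * x * (- \<i> * p * x) = - \<i>" using qr by simp
    qed (use x0 qr 6 in simp_all)
    moreover have "ext_act (pair_iii L \<xi>0 \<xi>L k) \<in> normal_forms L V" unfolding normal_forms_eq by blast
    ultimately show ?thesis using h by blast
  next
    case 7
    then have "q * r = -1" by (auto simp: qr_eq)
    then have qr: "q * r = -1" "q \<noteq> 0" by auto
    obtain x b' c' where x: "x \<noteq> 0" "b = x\<^sup>2 * b'" "c * x\<^sup>2 = c'" "reduced_vi b' c'"
      by (rule reduced_vi_exists)
    have h: "hol (ext_act (pair_vi L (\<i> * a) b' c')) (mat2 0 (- \<i>) (- \<i>) 0) (mat2 a b' c' (- a))"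
      using hol_vii[of "\<i> * a" b' c'] by simp
    have "x * (\<i> * q / x) = \<i> * q" "r * x * (\<i> * q / x) = \<i> * (q * r)" using x by simp_all
    then have "torus_related x (\<i> * q / x) M B (mat2 0 (- \<i>) (- \<i>) 0) (mat2 a b' c' (- a))"
      using x qr 7 by (simp add: Meq Beq torus_related_mat2 mult.commute[of _ \<i>])
    moreover have "ext_act (pair_vi L (\<i> * a) b' c') \<in> normal_forms L VII"
      unfolding normal_forms_eq using x(4) by blast
    ultimately show ?thesis using h by blast
  qed
qed

lemma normal_form_D_all: "normal_forms L k \<subseteq> D_all L"
  using normal_form_hol[of _ k] unfolding hol_def by blast

text \<open>Both representatives are related to the holonomy of \<open>P\<close>, hence to each
  other. The zero pattern gives the item, and \<open>normal_form_unique\<close> then gives the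
  pair.\<close>

lemma normal_form_rigid:
  assumes P: "P \<in> D_all L" and g: "g \<in> carrier (gauge_lift L)" "gauge_act L g P \<in> normal_forms L k"
    and h: "h \<in> carrier (gauge_lift L)" "gauge_act L h P \<in> normal_forms L k'"
  shows "k = k'" "gauge_act L g P = gauge_act L h P"
proof -
  obtain M B where 0: "hol P M B" using hol_exists[OF P] .
  obtain M1 B1 where 1: "hol (gauge_act L g P) M1 B1"
    "zero_pattern k = (M1$1$1 = 0, M1$1$2 = 0, M1$2$1 = 0, M1$2$2 = 0)"
    using normal_form_hol[OF g(2)] .
  obtain M2 B2 where 2: "hol (gauge_act L h P) M2 B2"
    "zero_pattern k' = (M2$1$1 = 0, M2$1$2 = 0, M2$2$1 = 0, M2$2$2 = 0)"
    using normal_form_hol[OF h(2)] .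
  obtain x1 y1 where r1: "torus_related x1 y1 M B M1 B1"
    using gauge_lift_torus_related[OF 0 1(1) g(1) refl] .
  obtain x2 y2 where r2: "torus_related x2 y2 M B M2 B2"
    using gauge_lift_torus_related[OF 0 2(1) h(1) refl] .
  note r = torus_related_trans[OF r1 r2]
  show k: "k = k'"
    by (rule zero_pattern_inj) (simp add: 1(2) 2(2) torus_related_zero_iff[OF r])
  show "gauge_act L g P = gauge_act L h P"
    using normal_form_unique[OF g(2) h(2)[folded k] 1(1) 2(1) r] .
qed

end

theorem mainTheorem2:
  fixes L :: real
  assumes "L > 0"
  shows "(\<forall>k. normal_forms L k \<subseteq> D_all L) \<and>
    (\<forall>Orb \<in> orbits (gauge_group L) (D_all L) (gauge_act_mod L).
       (\<exists>!p. p \<in> Orb \<and> (\<exists>k. p \<in> normal_forms L k)) \<and>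
       (\<forall>p \<in> Orb. \<forall>k k'. p \<in> normal_forms L k \<and> p \<in> normal_forms L k' \<longrightarrow> k = k')) \<and>
    (\<forall>k. \<forall>p \<in> normal_forms L k.
       if p \<in> first_pairs L
       then (gauge_group L)\<lparr>carrier := stabilizer (gauge_group L) (gauge_act_mod L) p\<rparr> \<cong> C_times
       else stabilizer (gauge_group L) (gauge_act_mod L) p = {\<one>\<^bsub>gauge_group L\<^esub>})"
proof -
  interpret interval L by unfold_locales (rule assms)
  have "(\<exists>!p. p \<in> Orb \<and> (\<exists>k. p \<in> normal_forms L k)) \<and>
      (\<forall>p \<in> Orb. \<forall>k k'. p \<in> normal_forms L k \<and> p \<in> normal_forms L k' \<longrightarrow> k = k')"
    if Orb: "Orb \<in> orbits (gauge_group L) (D_all L) (gauge_act_mod L)" for Orb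
  proof -
    obtain P where P: "P \<in> D_all L" "Orb = (\<lambda>g. gauge_act L g P) ` carrier (gauge_lift L)"
      using Orb by (auto simp: orbits_def orbit_eq)
    obtain M B where h: "hol P M B" "M \<in> SL2" "B \<in> sl2" using hol_exists[OF P(1)] .
    obtain k Q M' B' x y where Q: "Q \<in> normal_forms L k" "hol Q M' B'" "torus_related x y M B M' B'"
      using normal_form_exists[OF h(2,3)] by blast
    obtain g where "g \<in> carrier (gauge_lift L)" "gauge_act L g P = Q"
      using torus_related_gauge_lift[OF h(1) Q(2,3)] by blast
    then have "Q \<in> Orb" using P(2) by blast
    moreover have "k1 = k2 \<and> p1 = p2"
      if "p1 \<in> Orb" "p2 \<in> Orb" "p1 \<in> normal_forms L k1" "p2 \<in> normal_forms L k2" for p1 p2 k1 k2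
      using normal_form_rigid[OF P(1)] that unfolding P(2) by blast
    ultimately show ?thesis using Q(1) by blast
  qed
  moreover have "if p \<in> first_pairs L
      then (gauge_group L)\<lparr>carrier := stabilizer (gauge_group L) (gauge_act_mod L) p\<rparr> \<cong> C_times
      else stabilizer (gauge_group L) (gauge_act_mod L) p = {\<one>\<^bsub>gauge_group L\<^esub>}"
    if p: "p \<in> normal_forms L k" for p k
  proof (cases "p \<in> first_pairs L")
    case True
    obtain M B where "hol p M B" "\<And>x. x \<noteq> 0 \<Longrightarrow> \<exists>y. torus_related x y M B M B"
      using first_pair_torus[OF True] by blast
    from stabilizer_C_times[OF this] show ?thesis using True by simp
  next
    case False
    obtain M B where h: "hol p M B" using normal_form_hol[OF p] .
    have "stabilizer (gauge_group L) (gauge_act_mod L) p = {\<one>\<^bsub>gauge_group L\<^esub>}"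
      by (rule stabilizer_trivial[OF h]) (rule normal_form_stabilizer[OF p False h])
    then show ?thesis using False by simp
  qed
  ultimately show ?thesis
    by (intro conjI[OF allI[OF normal_form_D_all] conjI] ballI allI)
qed

end
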